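(* Let $n\ge 3$, $m\ge 2$, $k\ge 1$ be integers, and for $i\in\{1,2,\ldots,k\}$ let $\boldsymbol{f}_i(\boldsymbol{\eta})=(f_{i,1}(\boldsymbol{\eta}),f_{i,3}(\boldsymbol{\eta}),\ldots,f_{i,n}(\boldsymbol{\eta}))$ be the $i$th-order averaged function associated to the standard form of averaging $(\mathrm{SF})$ described in the context, where $\boldsymbol{\eta}=(R,X_3,\ldots,X_n)$. Then for each $j\in\{1,3,\ldots,n\}$ there exists a smallest nonnegative integer $\mu_{i,j}\le i-1$ such that $\bar f_{i,j}(\boldsymbol{\eta}):=R^{\mu_{i,j}}f_{i,j}(\boldsymbol{\eta})\in\mathcal{R}[\boldsymbol{\eta}]$. Moreover, for each $j$, $\bar f_{i,j}(\boldsymbol{\eta})$ is a polynomial in $\mathcal{R}[\boldsymbol{\eta}]$ of total degree (in $R,X_3,\ldots,X_n$) no more than $im$.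
   Context: Perturbed system: $$\dot{x}_1=\sum_{j=1}^k a_j\varepsilon^j x_1-\Big(b+\sum_{j=1}^k b_j\varepsilon^j\Big)x_2+\sum_{i_1+\cdots+i_n=m}p_{1,i_1,\ldots,i_n}x_1^{i_1}\cdots x_n^{i_n},$$ $$\dot{x}_2=\Big(b+\sum_{j=1}^k b_j\varepsilon^j\Big)x_1+\sum_{j=1}^k a_j\varepsilon^j x_2+\sum_{i_1+\cdots+i_n=m}p_{2,i_1,\ldots,i_n}x_1^{i_1}\cdots x_n^{i_n},$$ $$\dot{x}_s=\sum_{j=1}^k c_{s,j}\varepsilon^j x_s+\sum_{i_1+\cdots+i_n=m}p_{s,i_1,\ldots,i_n}x_1^{i_1}\cdots x_n^{i_n},\quad s=3,\ldots,n,$$ with $p_{s,i_1,\ldots,i_n}=\sum_{j=1}^k\varepsilon^{j-1}p_{s,i_1,\ldots,i_n,j-1}$; here $b\ne 0$, $a_j,b_j,c_{s,j},p_{s,i_1,\ldots,i_n,j-1}$ are real parameters and $\varepsilon$ is the perturbation parameter. Standard form $(\mathrm{SF})$: after the changes $x_1=r\cos\theta$, $x_2=r\sin\theta$ ($r>0$), taking $\theta$ as independent variable, and $(r,x_3,\ldots,x_n)=\varepsilon^{1/(m-1)}(R,X_3,\ldots,X_n)$, the system becomes $$\frac{dR}{d\theta}=\frac{R\sum_{i=1}^k\varepsilon^iS_{i,1}}{bR+\sum_{i=1}^k\varepsilon^iS_{i,2}}=\sum_{i=1}^k\varepsilon^iF_{i,1}+\mathcal{O}(\varepsilon^{k+1}),\qquad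 \frac{dX_s}{d\theta}=\frac{R\sum_{i=1}^k\varepsilon^iS_{i,s}}{bR+\sum_{i=1}^k\varepsilon^iS_{i,2}}=\sum_{i=1}^k\varepsilon^iF_{i,s}+\mathcal{O}(\varepsilon^{k+1}),\quad s=3,\ldots,n,$$ where the functions $F_{i,j}(\theta,R,X_3,\ldots,X_n)$ are the Taylor coefficients in $\varepsilon$ at $\varepsilon=0$, and, with sums over $i_1+\cdots+i_n=m$, $$S_{i,1}=a_iR+\sum(p_{1,i_1,\ldots,i_n,i-1}\cos\theta+p_{2,i_1,\ldots,i_n,i-1}\sin\theta)(R\cos\theta)^{i_1}(R\sin\theta)^{i_2}X_3^{i_3}\cdots X_n^{i_n},$$ $$S_{i,2}=b_iR+\sum(p_{2,i_1,\ldots,i_n,i-1}\cos\theta-p_{1,i_1,\ldots,i_n,i-1}\sin\theta)(R\cos\theta)^{i_1}(R\sin\theta)^{i_2}X_3^{i_3}\cdots X_n^{i_n},$$ $$S_{i,s}=c_{s,i}X_s+\sum p_{s,i_1,\ldots,i_n,i-1}(R\cos\theta)^{i_1}(R\sin\theta)^{i_2}X_3^{i_3}\cdots X_n^{i_n},\quad s=3,\ldots,n.$$ Averaged functions: put $\boldsymbol{F}_i=(F_{i,1},F_{i,3},\ldots,F_{i,n})$ and define recursively $\boldsymbol{y}_1(\theta,\boldsymbol{\eta})=\int_0^\theta\boldsymbol{F}_1(\tau,\boldsymbol{\eta})\,d\tau$ and $$\boldsymbol{y}_i(\theta,\boldsymbol{\eta})=i!\int_0^\theta\Big(\boldsymbol{F}_i(\tau,\boldsymbol{\eta})+\sum_{\ell=1}^{i-1}\sum_{S_\ell}\frac{1}{\beta_1!\,\beta_2!\,2!^{\beta_2}\cdots\beta_\ell!\,\ell!^{\beta_\ell}}\,\partial^L\boldsymbol{F}_{i-\ell}(\tau,\boldsymbol{\eta})\bigodot_{j=1}^{\ell}\boldsymbol{y}_j(\tau,\boldsymbol{\eta})^{\beta_j}\Big)d\tau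 ,$$ where $S_\ell$ is the set of $\ell$-tuples $[\beta_1,\ldots,\beta_\ell]$ of nonnegative integers with $\beta_1+2\beta_2+\cdots+\ell\beta_\ell=\ell$, $L=\beta_1+\cdots+\beta_\ell$, $\partial^L\boldsymbol{F}$ is the $L$th Fréchet derivative (symmetric $L$-multilinear map) with respect to $\boldsymbol{\eta}$, and it is applied to the list in which each $\boldsymbol{y}_j$ appears $\beta_j$ times. The $i$th-order averaged function is $\boldsymbol{f}_i(\boldsymbol{\eta})=\boldsymbol{y}_i(2\pi,\boldsymbol{\eta})/i!$. $\mathcal{R}[\boldsymbol{\eta}]$ denotes the polynomial ring $\mathbb{R}(\boldsymbol{p})[\boldsymbol{\eta}]$, where $\boldsymbol{p}$ is the set of all parameters of the perturbed system other than $\varepsilon$. *)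

theory Defs
  imports
    "HOL-Analysis.Analysis"
    "HOL-Library.Poly_Mapping"
    "HOL-Library.Countable"
    "HOL-Computational_Algebra.Fraction_Field"
begin

text \<open>
  The dimension is \<open>n = CARD('d) + 2\<close>: the coordinates \<open>x\<^sub>3, \<dots>, x\<^sub>n\<close> of the phase space are
  indexed by the finite type \<open>'d\<close>. The averaged variables \<open>\<eta> = (R, X\<^sub>3, \<dots>, X\<^sub>n)\<close> form a vector
  in \<open>real ^ ('d option)\<close>, with \<open>\<eta> $ None = R\<close> and \<open>\<eta> $ Some s = X\<^sub>s\<close>; the index set
  \<open>{1, 3, \<dots>, n}\<close> of the components of \<open>\<^bold>F\<^sub>i\<close>, \<open>\<^bold>y\<^sub>i\<close>, \<open>\<^bold>f\<^sub>i\<close> is likewise \<open>'d option\<close>.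
\<close>

datatype 'd coord = X1 | X2 | Xs 'd

lemma UNIV_coord: "UNIV = insert X1 (insert X2 (range Xs))"
  by (auto intro: coord.exhaust)

instance coord :: (finite) finite
  by standard (simp add: UNIV_coord)

text \<open>
  The parameters \<open>b\<close>, \<open>a\<^sub>j\<close>, \<open>b\<^sub>j\<close>, \<open>c\<^sub>s\<^sub>,\<^sub>j\<close> and \<open>p\<close>. In \<open>PP e \<iota> l\<close>, \<open>e\<close> is the equation, \<open>\<iota>\<close> the
  exponent vector \<open>(i\<^sub>1, \<dots>, i\<^sub>n)\<close> and \<open>l = j - 1\<close> the power of \<open>\<epsilon>\<close>.
\<close>

datatype 'd param =
    PB
  | PA nat
  | PBeta nat
  | PC 'd nat
  | PP "'d coord" "'d coord \<Rightarrow> nat" nat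

instance param :: (finite) countable
proof
  define g :: "'a param \<Rightarrow> nat + nat + nat + ('a \<times> nat) + ('a coord \<times> ('a coord \<Rightarrow> nat) \<times> nat)"
    where "g = (\<lambda>p. case p of
      PB \<Rightarrow> Inl 0
    | PA j \<Rightarrow> Inr (Inl j)
    | PBeta j \<Rightarrow> Inr (Inr (Inl j))
    | PC s j \<Rightarrow> Inr (Inr (Inr (Inl (s, j))))
    | PP e \<iota> l \<Rightarrow> Inr (Inr (Inr (Inr (e, \<iota>, l)))))"
  have "inj g"
    by (rule injI) (auto simp: g_def split: param.splits)
  then have "inj (to_nat \<circ> g)"
    by (simp add: inj_compose)
  then show "\<exists>f :: 'a param \<Rightarrow> nat. inj f"
    by blast
qed

text \<open>
  An arbitrary linear order on the parameters. It only serves to make polynomials in the parameters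
  an integral domain for the type system, the library instance being restricted to ordered
  monoids of exponents.
\<close>

instantiation param :: (finite) linorder
begin

definition "x \<le> y \<longleftrightarrow> to_nat x \<le> to_nat y" for x y :: "'a param"

definition "x < y \<longleftrightarrow> to_nat x < to_nat y" for x y :: "'a param"

instance
  by standard (auto simp: less_eq_param_def less_param_def)

end

definition exponents :: "nat \<Rightarrow> ('d::finite coord \<Rightarrow> nat) set" where
  "exponents m = {\<iota>. (\<Sum>x\<in>UNIV. \<iota> x) = m}"

definition params :: "nat \<Rightarrow> nat \<Rightarrow> ('d::finite) param set" where
  "params m k =
     {PB} \<union> PA ` {1..k} \<union> PBeta ` {1..k} \<union> {PC s j |s j. j \<in> {1..k}}
       \<union> {PP e \<iota> l |e \<iota> l. \<iota> \<in> exponents m \<and> l < k}"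

text \<open>
  The underlying perturbed system, with sums over \<open>j = 1..k\<close> and over exponent vectors \<open>\<iota>\<close> of
  total degree \<open>m\<close>, and \<open>p\<^sub>e\<^sub>,\<^sub>\<iota> = \<Sum>j. \<epsilon>\<^sup>j\<^sup>-\<^sup>1 p\<^sub>e\<^sub>,\<^sub>\<iota>\<^sub>,\<^sub>j\<^sub>-\<^sub>1\<close>, is

  \<open>x\<^sub>1' = (\<Sum>j. a\<^sub>j \<epsilon>\<^sup>j) x\<^sub>1 - (b + \<Sum>j. b\<^sub>j \<epsilon>\<^sup>j) x\<^sub>2 + (\<Sum>\<iota>. p\<^sub>1\<^sub>,\<^sub>\<iota> x\<^sup>\<iota>)\<close>,

  \<open>x\<^sub>2' = (b + \<Sum>j. b\<^sub>j \<epsilon>\<^sup>j) x\<^sub>1 + (\<Sum>j. a\<^sub>j \<epsilon>\<^sup>j) x\<^sub>2 + (\<Sum>\<iota>. p\<^sub>2\<^sub>,\<^sub>\<iota> x\<^sup>\<iota>)\<close>,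

  \<open>x\<^sub>s' = (\<Sum>j. c\<^sub>s\<^sub>,\<^sub>j \<epsilon>\<^sup>j) x\<^sub>s + (\<Sum>\<iota>. p\<^sub>s\<^sub>,\<^sub>\<iota> x\<^sup>\<iota>)\<close>.

  Polar coordinates in \<open>(x\<^sub>1, x\<^sub>2)\<close>, the angle as independent variable and the scaling
  \<open>(r, x\<^sub>3, \<dots>, x\<^sub>n) = \<epsilon>\<^sup>1\<^sup>/\<^sup>(\<^sup>m\<^sup>-\<^sup>1\<^sup>) (R, X\<^sub>3, \<dots>, X\<^sub>n)\<close> turn it into \<open>d\<eta>\<^sub>j/d\<theta> = sf_rhs \<rho> m k j \<theta> \<eta> \<epsilon>\<close>, where
  \<open>\<rho>\<close> assigns values to the parameters; \<open>sf_coeff \<rho> m k i\<close> is the vector of its \<open>i\<close>-th Taylor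
  coefficients in \<open>\<epsilon>\<close> at \<open>0\<close>.
\<close>

definition sf_monom :: "real \<Rightarrow> real ^ ('d::finite option) \<Rightarrow> ('d coord \<Rightarrow> nat) \<Rightarrow> real" where
  "sf_monom \<theta> \<eta> \<iota> =
     (\<eta> $ None * cos \<theta>) ^ \<iota> X1 * (\<eta> $ None * sin \<theta>) ^ \<iota> X2 * (\<Prod>s\<in>UNIV. (\<eta> $ Some s) ^ \<iota> (Xs s))"

definition S1 :: "('d::finite param \<Rightarrow> real) \<Rightarrow> nat \<Rightarrow> nat \<Rightarrow> real \<Rightarrow> real ^ ('d option) \<Rightarrow> real" where
  "S1 \<rho> m i \<theta> \<eta> = \<rho> (PA i) * \<eta> $ None +
     (\<Sum>\<iota>\<in>exponents m. (\<rho> (PP X1 \<iota> (i - 1)) * cos \<theta> + \<rho> (PP X2 \<iota> (i - 1)) * sin \<theta>) * sf_monom \<theta> \<eta> \<iota>)"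

definition S2 :: "('d::finite param \<Rightarrow> real) \<Rightarrow> nat \<Rightarrow> nat \<Rightarrow> real \<Rightarrow> real ^ ('d option) \<Rightarrow> real" where
  "S2 \<rho> m i \<theta> \<eta> = \<rho> (PBeta i) * \<eta> $ None +
     (\<Sum>\<iota>\<in>exponents m. (\<rho> (PP X2 \<iota> (i - 1)) * cos \<theta> - \<rho> (PP X1 \<iota> (i - 1)) * sin \<theta>) * sf_monom \<theta> \<eta> \<iota>)"

definition Ss :: "('d::finite param \<Rightarrow> real) \<Rightarrow> nat \<Rightarrow> 'd \<Rightarrow> nat \<Rightarrow> real \<Rightarrow> real ^ ('d option) \<Rightarrow> real" where
  "Ss \<rho> m s i \<theta> \<eta> = \<rho> (PC s i) * \<eta> $ Some s +
     (\<Sum>\<iota>\<in>exponents m. \<rho> (PP (Xs s) \<iota> (i - 1)) * sf_monom \<theta> \<eta> \<iota>)"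

definition sf_rhs ::
    "('d::finite param \<Rightarrow> real) \<Rightarrow> nat \<Rightarrow> nat \<Rightarrow> 'd option \<Rightarrow> real \<Rightarrow> real ^ ('d option) \<Rightarrow> real \<Rightarrow> real" where
  "sf_rhs \<rho> m k j \<theta> \<eta> \<epsilon> =
     \<eta> $ None * (\<Sum>i=1..k. \<epsilon> ^ i * (case j of None \<Rightarrow> S1 \<rho> m i \<theta> \<eta> | Some s \<Rightarrow> Ss \<rho> m s i \<theta> \<eta>)) /
       (\<rho> PB * \<eta> $ None + (\<Sum>i=1..k. \<epsilon> ^ i * S2 \<rho> m i \<theta> \<eta>))"

definition sf_coeff ::
    "('d::finite param \<Rightarrow> real) \<Rightarrow> nat \<Rightarrow> nat \<Rightarrow> nat \<Rightarrow> real \<Rightarrow> real ^ ('d option) \<Rightarrow> real ^ ('d option)" where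
  "sf_coeff \<rho> m k i \<theta> \<eta> = (\<chi> j. (deriv ^^ i) (sf_rhs \<rho> m k j \<theta> \<eta>) 0 / fact i)"

text \<open>
  \<open>iter_frechet f x [v\<^sub>1, \<dots>, v\<^sub>L]\<close> is the \<open>L\<close>-th Frechet derivative of \<open>f\<close> at \<open>x\<close>, applied to
  \<open>(v\<^sub>1, \<dots>, v\<^sub>L)\<close>; only used for \<open>f\<close> smooth near \<open>x\<close>.
\<close>

fun iter_frechet :: "('a::real_normed_vector \<Rightarrow> 'b::real_normed_vector) \<Rightarrow> 'a \<Rightarrow> 'a list \<Rightarrow> 'b" where
  "iter_frechet f x [] = f x"
| "iter_frechet f x (v # vs) = frechet_derivative (\<lambda>z. iter_frechet f z vs) (at x) v"

text \<open>The tuple \<open>[\<beta>\<^sub>1, \<dots>, \<beta>\<^sub>l]\<close> is stored with \<open>\<beta>\<^sub>j = \<beta> ! (j - 1)\<close>.\<close>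

definition weight_tuples :: "nat \<Rightarrow> nat list set" where
  "weight_tuples l = {\<beta>. length \<beta> = l \<and> (\<Sum>j=1..l. j * \<beta> ! (j - 1)) = l}"

fun avg_y ::
    "(nat \<Rightarrow> real \<Rightarrow> 'a::euclidean_space \<Rightarrow> 'a) \<Rightarrow> nat \<Rightarrow> real \<Rightarrow> 'a \<Rightarrow> 'a" where
  "avg_y F i \<theta> \<eta> = fact i *\<^sub>R integral {0..\<theta>} (\<lambda>\<tau>. F i \<tau> \<eta> +
     (\<Sum>l\<in>{1..<i}. \<Sum>\<beta>\<in>weight_tuples l.
        (1 / (\<Prod>j=1..l. fact (\<beta> ! (j - 1)) * fact j ^ (\<beta> ! (j - 1)))) *\<^sub>R
          iter_frechet (F (i - l) \<tau>) \<eta>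
            (concat (map (\<lambda>j. replicate (\<beta> ! (j - 1)) (avg_y F j \<tau> \<eta>)) [1..<Suc l]))))"

declare avg_y.simps [simp del]

definition averaged_fun ::
    "('d::finite param \<Rightarrow> real) \<Rightarrow> nat \<Rightarrow> nat \<Rightarrow> nat \<Rightarrow> real ^ ('d option) \<Rightarrow> real ^ ('d option)" where
  "averaged_fun \<rho> m k i \<eta> = avg_y (sf_coeff \<rho> m k) i (2 * pi) \<eta> /\<^sub>R fact i"

type_synonym ('v, 'c) mpoly = "('v \<Rightarrow>\<^sub>0 nat) \<Rightarrow>\<^sub>0 'c"

type_synonym 'v ratfun = "('v, real) mpoly fract"

text \<open>\<open>h\<close> specializes the coefficients, \<open>x\<close> the variables.\<close>

definition mpoly_eval :: "('c::zero \<Rightarrow> real) \<Rightarrow> ('v \<Rightarrow> real) \<Rightarrow> ('v, 'c) mpoly \<Rightarrow> real" where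
  "mpoly_eval h x P =
     (\<Sum>u\<in>Poly_Mapping.keys P. h (Poly_Mapping.lookup P u) *
        (\<Prod>v\<in>Poly_Mapping.keys u. x v ^ Poly_Mapping.lookup u v))"

definition mpoly_total_degree :: "('v, 'c::zero) mpoly \<Rightarrow> nat" where
  "mpoly_total_degree P =
     Max (insert 0 ((\<lambda>u. \<Sum>v\<in>Poly_Mapping.keys u. Poly_Mapping.lookup u v) ` Poly_Mapping.keys P))"

definition mpolys :: "'v set \<Rightarrow> ('v, 'c::zero) mpoly set" where
  "mpolys V = {P. \<forall>u\<in>Poly_Mapping.keys P. Poly_Mapping.keys u \<subseteq> V}"

definition ratfuns :: "'v::linorder set \<Rightarrow> 'v ratfun set" where
  "ratfuns V = {Fract N D |N D. N \<in> mpolys V \<and> D \<in> mpolys V \<and> D \<noteq> 0}"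

definition ratfun_defined_at :: "'v::linorder ratfun \<Rightarrow> ('v \<Rightarrow> real) \<Rightarrow> bool" where
  "ratfun_defined_at q \<rho> \<longleftrightarrow> (\<exists>N D. q = Fract N D \<and> mpoly_eval id \<rho> D \<noteq> 0)"

definition ratfun_eval :: "('v \<Rightarrow> real) \<Rightarrow> 'v::linorder ratfun \<Rightarrow> real" where
  "ratfun_eval \<rho> q =
     (THE c. \<exists>N D. q = Fract N D \<and> mpoly_eval id \<rho> D \<noteq> 0 \<and>
        c = mpoly_eval id \<rho> N / mpoly_eval id \<rho> D)"

text \<open>The ring \<open>\<real>(p)[\<eta>]\<close>, with \<open>p\<close> the parameters that occur for the given \<open>m\<close> and \<open>k\<close>.\<close>

definition eta_polys :: "nat \<Rightarrow> nat \<Rightarrow> ('d::finite option, 'd param ratfun) mpoly set" where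
  "eta_polys m k = {Q. \<forall>u. Poly_Mapping.lookup Q u \<in> ratfuns (params m k)}"

text \<open>
  A function of the parameters and of \<open>\<eta>\<close>, considered for \<open>b \<noteq> 0\<close> and \<open>R > 0\<close>, is identified with
  the element \<open>Q\<close> of the ring if it agrees with \<open>Q\<close> wherever the coefficients of \<open>Q\<close>, which are
  rational functions of the parameters, are defined.
\<close>

definition represents ::
    "('d::finite option, 'd param ratfun) mpoly \<Rightarrow>
     (('d param \<Rightarrow> real) \<Rightarrow> real ^ ('d option) \<Rightarrow> real) \<Rightarrow> bool" where
  "represents Q g \<longleftrightarrow>
     (\<forall>\<rho> \<eta>. \<rho> PB \<noteq> 0 \<longrightarrow> \<eta> $ None > 0 \<longrightarrow>
        (\<forall>u. ratfun_defined_at (Poly_Mapping.lookup Q u) \<rho>) \<longrightarrow>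
        g \<rho> \<eta> = mpoly_eval (ratfun_eval \<rho>) (($) \<eta>) Q)"

definition scaled_averaged_fun ::
    "nat \<Rightarrow> nat \<Rightarrow> nat \<Rightarrow> 'd::finite option \<Rightarrow> nat \<Rightarrow> ('d param \<Rightarrow> real) \<Rightarrow> real ^ ('d option) \<Rightarrow> real" where
  "scaled_averaged_fun m k i j \<mu> \<rho> \<eta> = (\<eta> $ None) ^ \<mu> * averaged_fun \<rho> m k i \<eta> $ j"

end

theory Submission
  imports Defs "HOL-Computational_Algebra.Primes"
begin

text \<open>
  Say that a finite sum \<open>R\<^sup>-\<^sup>e \<Sum> c(p) \<phi>(\<theta>) \<eta>\<^sup>u\<close> with \<open>deg u \<le> D\<close>, whose coefficients \<open>c\<close> are
  polynomials in the parameters divided by powers of \<open>b\<close>, has type \<open>(e, D)\<close>. Types add under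
  multiplication, are preserved by integration over \<open>\<theta>\<close>, and a partial derivative turns
  \<open>(e, D)\<close> into \<open>(e + 1, D)\<close>. Comparing powers of \<open>\<epsilon>\<close> in \<open>(SF)\<close> gives
  \<open>b R F\<^sub>i = R S\<^sub>i - \<Sum>\<^sub>l F\<^sub>l S\<^sub>i\<^sub>-\<^sub>l\<^sub>,\<^sub>2\<close>, so \<open>F\<^sub>i\<close> has type \<open>(i - 1, i m)\<close>; since
  \<open>\<Sum>\<^sub>j j \<beta>\<^sub>j = l\<close>, so has every term \<open>\<partial>\<^sup>L F\<^sub>i\<^sub>-\<^sub>l\<close> applied to \<open>\<beta>\<^sub>j\<close> copies of the \<open>y\<^sub>j\<close>, and hence
  \<open>y\<^sub>i\<close>. Thus \<open>R\<^sup>i\<^sup>-\<^sup>1 f\<^sub>i\<close> is a polynomial of degree at most \<open>i m\<close>. For the least admissible \<open>\<mu>\<close>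
  this polynomial is divisible by \<open>R\<^sup>i\<^sup>-\<^sup>1\<^sup>-\<^sup>\<mu>\<close>, and the quotient still satisfies the degree bound.
\<close>

section \<open>Evaluation of polynomials and rational functions\<close>

definition monomial_eval :: "('v \<Rightarrow> real) \<Rightarrow> ('v \<Rightarrow>\<^sub>0 nat) \<Rightarrow> real" where
  "monomial_eval x u = (\<Prod>v\<in>Poly_Mapping.keys u. x v ^ Poly_Mapping.lookup u v)"

lemma monomial_eval_superset:
  assumes "finite V" "Poly_Mapping.keys u \<subseteq> V"
  shows "monomial_eval x u = (\<Prod>v\<in>V. x v ^ Poly_Mapping.lookup u v)"
  unfolding monomial_eval_def
  by (rule prod.mono_neutral_left) (use assms in \<open>auto simp: in_keys_iff\<close>)

lemma monomial_eval_finite: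
  "monomial_eval x u = (\<Prod>v\<in>UNIV. x v ^ Poly_Mapping.lookup u v)" for u :: "'v::finite \<Rightarrow>\<^sub>0 nat"
  by (rule monomial_eval_superset) auto

lemma monomial_eval_0 [simp]: "monomial_eval x 0 = 1"
  by (simp add: monomial_eval_def)

lemma monomial_eval_single [simp]: "monomial_eval x (Poly_Mapping.single v n) = x v ^ n"
  by (simp add: monomial_eval_def)

lemma monomial_eval_add: "monomial_eval x (u + w) = monomial_eval x u * monomial_eval x w"
proof -
  let ?V = "Poly_Mapping.keys u \<union> Poly_Mapping.keys w"
  have "Poly_Mapping.keys (u + w) \<subseteq> ?V"
    by (rule keys_add)
  then show ?thesis
    by (simp add: monomial_eval_superset[of ?V] lookup_add power_add prod.distrib)
qed

lemma mpoly_eval_superset: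
  assumes "finite U" "Poly_Mapping.keys P \<subseteq> U" "h 0 = 0"
  shows "mpoly_eval h x P = (\<Sum>u\<in>U. h (Poly_Mapping.lookup P u) * monomial_eval x u)"
  unfolding mpoly_eval_def monomial_eval_def
  by (rule sum.mono_neutral_left) (use assms in \<open>auto simp: in_keys_iff\<close>)

lemma mpoly_eval_single:
  assumes "h 0 = 0"
  shows "mpoly_eval h x (Poly_Mapping.single u c) = h c * monomial_eval x u"
  using assms by (subst mpoly_eval_superset[of "{u}"]) auto

text \<open>Additivity of \<open>h\<close> is asked only at the coefficients that occur: for
  \<open>h = ratfun_eval \<rho>\<close> it is available only for fractions whose denominators do not
  vanish at \<open>\<rho>\<close>.\<close>

lemma mpoly_eval_add:
  fixes P Q :: "('v, 'c::monoid_add) mpoly"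
  assumes "h 0 = 0"
    and "\<And>u. h (Poly_Mapping.lookup P u + Poly_Mapping.lookup Q u) =
      h (Poly_Mapping.lookup P u) + h (Poly_Mapping.lookup Q u)"
  shows "mpoly_eval h x (P + Q) = mpoly_eval h x P + mpoly_eval h x Q"
proof -
  let ?U = "Poly_Mapping.keys P \<union> Poly_Mapping.keys Q"
  have "Poly_Mapping.keys (P + Q) \<subseteq> ?U"
    by (rule keys_add)
  then show ?thesis
    using assms by (simp add: mpoly_eval_superset[of ?U] lookup_add distrib_right sum.distrib)
qed

text \<open>The case of real coefficients serves twice: for numerators and denominators in the
  parameters, and for polynomials in \<eta> once the parameters are specialized.\<close>

definition real_mpoly_eval :: "('v \<Rightarrow> real) \<Rightarrow> ('v, real) mpoly \<Rightarrow> real" where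
  "real_mpoly_eval = mpoly_eval id"

lemma real_mpoly_eval_superset:
  assumes "finite U" "Poly_Mapping.keys P \<subseteq> U"
  shows "real_mpoly_eval x P = (\<Sum>u\<in>U. Poly_Mapping.lookup P u * monomial_eval x u)"
  unfolding real_mpoly_eval_def using mpoly_eval_superset[OF assms, of id x] by simp

lemma real_mpoly_eval_single [simp]:
  "real_mpoly_eval x (Poly_Mapping.single u c) = c * monomial_eval x u"
  by (subst real_mpoly_eval_superset[of "{u}"]) auto

lemma real_mpoly_eval_0 [simp]: "real_mpoly_eval x 0 = 0"
  by (simp add: real_mpoly_eval_def mpoly_eval_def)

lemma real_mpoly_eval_1 [simp]: "real_mpoly_eval x 1 = 1"
  by (simp flip: single_one)

lemma real_mpoly_eval_add: "real_mpoly_eval x (P + Q) = real_mpoly_eval x P + real_mpoly_eval x Q"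
  unfolding real_mpoly_eval_def by (rule mpoly_eval_add) auto

lemma real_mpoly_eval_sum: "real_mpoly_eval x (\<Sum>i\<in>I. P i) = (\<Sum>i\<in>I. real_mpoly_eval x (P i))"
  by (induction I rule: infinite_finite_induct) (auto simp: real_mpoly_eval_add)

lemma mpoly_as_sum:
  "P = (\<Sum>u\<in>Poly_Mapping.keys P. Poly_Mapping.single u (Poly_Mapping.lookup P u))"
  by (rule poly_mapping_eqI) (auto simp: lookup_sum lookup_single when_def in_keys_iff)

lemma real_mpoly_eval_mult: "real_mpoly_eval x (P * Q) = real_mpoly_eval x P * real_mpoly_eval x Q"
proof -
  have "P * Q = (\<Sum>u\<in>Poly_Mapping.keys P. \<Sum>w\<in>Poly_Mapping.keys Q.
      Poly_Mapping.single (u + w) (Poly_Mapping.lookup P u * Poly_Mapping.lookup Q w))"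
    by (subst mpoly_as_sum[of P], subst mpoly_as_sum[of Q]) (simp add: sum_product mult_single)
  then show ?thesis
    by (simp add: real_mpoly_eval_sum monomial_eval_add real_mpoly_eval_superset[of "Poly_Mapping.keys P" P]
        real_mpoly_eval_superset[of "Poly_Mapping.keys Q" Q] sum_product mult_ac)
qed

lemma real_mpoly_eval_prod: "real_mpoly_eval x (\<Prod>i\<in>I. P i) = (\<Prod>i\<in>I. real_mpoly_eval x (P i))"
  by (induction I rule: infinite_finite_induct) (auto simp: real_mpoly_eval_mult)

lemma mpolys_0 [simp]: "0 \<in> mpolys V"
  by (simp add: mpolys_def)

lemma mpolys_const [simp]: "Poly_Mapping.single 0 c \<in> mpolys V"
  by (simp add: mpolys_def)

lemma mpolys_1 [simp]: "1 \<in> mpolys V"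
  by (simp add: mpolys_def)

lemma mpolys_add: "P \<in> mpolys V \<Longrightarrow> Q \<in> mpolys V \<Longrightarrow> P + Q \<in> mpolys V"
  using keys_add[of P Q] by (fastforce simp: mpolys_def)

lemma mpolys_mult:
  assumes "P \<in> mpolys V" "Q \<in> mpolys V"
  shows "P * Q \<in> mpolys V"
  unfolding mpolys_def
proof (intro CollectI ballI subsetI)
  fix u v assume "u \<in> Poly_Mapping.keys (P * Q)" and v: "v \<in> Poly_Mapping.keys u"
  then obtain a b where "u = a + b" "a \<in> Poly_Mapping.keys P" "b \<in> Poly_Mapping.keys Q"
    using keys_mult[of P Q] by auto
  then show "v \<in> V"
    using v keys_add[of a b] assms by (auto simp: mpolys_def)
qed

section \<open>Real polynomials that vanish at all positive points\<close>

lemma exponential_sum_eq_0: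
  fixes c :: "'a \<Rightarrow> real"
  assumes "finite U" "inj_on N U" and zero: "\<And>t. (\<Sum>u\<in>U. c u * N u ^ t) = 0" and "u \<in> U"
  shows "c u = 0"
proof -
  \<comment> \<open>Linearity passes from the powers \<open>N u ^ t\<close> to every polynomial in
    \<open>N u\<close>.\<close>
  have poly0: "(\<Sum>u\<in>U. c u * poly p (N u)) = 0" for p
  proof -
    have "(\<Sum>u\<in>U. c u * poly p (N u)) = (\<Sum>t\<le>degree p. coeff p t * (\<Sum>u\<in>U. c u * N u ^ t))"
      unfolding poly_altdef sum_distrib_left by (subst sum.swap) (simp add: mult_ac)
    then show ?thesis
      by (simp add: zero)
  qed
  \<comment> \<open>Up to a scalar this is the Lagrange basis polynomial: among the nodes it is
    nonzero only at \<open>N u\<close>.\<close>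
  define p where "p = (\<Prod>w\<in>U - {u}. [:- N w, 1:])"
  have "poly p (N w) = 0" if "w \<in> U" "w \<noteq> u" for w
    using that \<open>finite U\<close> by (auto simp: p_def poly_prod)
  then have "(\<Sum>w\<in>U. c w * poly p (N w)) = c u * poly p (N u)"
    using assms by (subst sum.remove[of _ u]) (auto intro!: sum.neutral)
  moreover have "poly p (N u) \<noteq> 0"
    using assms(1,2,4) by (auto simp: p_def poly_prod inj_on_def)
  ultimately show ?thesis
    using poly0[of p] by simp
qed

text \<open>Assign distinct primes to the variables that occur and substitute their
  \<open>t\<close>-th powers. By unique factorization distinct monomials become \<open>t\<close>-th
  powers of distinct integers, so \<open>exponential_sum_eq_0\<close> kills every coefficient. The
  points are positive, as the identities to be compared are only known for R > 0.\<close>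

lemma mpoly_eq_0_if_eval_eq_0:
  fixes P :: "('v, real) mpoly"
  assumes zero: "\<And>x. (\<And>v. x v > 0) \<Longrightarrow> real_mpoly_eval x P = 0"
  shows "P = 0"
proof -
  define V where "V = (\<Union>u\<in>Poly_Mapping.keys P. Poly_Mapping.keys u)"
  have fin: "finite V"
    by (simp add: V_def)
  obtain f :: "'v \<Rightarrow> nat" where f: "inj_on f V" "f ` V \<subseteq> {p. prime p}"
    using infinite_arbitrarily_large[OF primes_infinite, of "card V"] fin
    by (metis card_le_inj order_refl subset_trans)
  define N where "N u = (\<Prod>v\<in>V. f v ^ Poly_Mapping.lookup u v)" for u
  have mult: "multiplicity (f v) (N u) = Poly_Mapping.lookup u v" if "v \<in> V" for u v
  proof -
    have "N u = (\<Prod>p\<in>f ` V. p ^ Poly_Mapping.lookup u (the_inv_into V f p))"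
      unfolding N_def using f by (subst prod.reindex) (auto simp: the_inv_into_f_f)
    also have "multiplicity (f v) \<dots> = Poly_Mapping.lookup u v"
      using f that fin by (subst multiplicity_prod_prime_powers) (auto simp: the_inv_into_f_f)
    finally show ?thesis .
  qed
  have "inj_on N (Poly_Mapping.keys P)"
  proof (rule inj_onI, rule poly_mapping_eqI)
    fix u w v assume uw: "u \<in> Poly_Mapping.keys P" "w \<in> Poly_Mapping.keys P" "N u = N w"
    show "Poly_Mapping.lookup u v = Poly_Mapping.lookup w v"
    proof (cases "v \<in> V")
      case True
      then show ?thesis
        using mult[of v u] mult[of v w] uw by simp
    next
      case False
      then have "v \<notin> Poly_Mapping.keys u" "v \<notin> Poly_Mapping.keys w"
        using uw by (auto simp: V_def)
      then show ?thesis
        by (simp add: in_keys_iff)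
    qed
  qed
  then have inj: "inj_on (\<lambda>u. real (N u)) (Poly_Mapping.keys P)"
    by (auto simp: inj_on_def)
  have "(\<Sum>u\<in>Poly_Mapping.keys P. Poly_Mapping.lookup P u * real (N u) ^ t) = 0" for t
  proof -
    \<comment> \<open>The value 1 outside \<open>V\<close> keeps every coordinate positive.\<close>
    define x where "x v = (if v \<in> V then real (f v) ^ t else 1)" for v
    have "x v > 0" for v
      using f prime_gt_0_nat by (auto simp: x_def)
    then have "0 = real_mpoly_eval x P"
      by (simp add: zero)
    also have "\<dots> = (\<Sum>u\<in>Poly_Mapping.keys P. Poly_Mapping.lookup P u * monomial_eval x u)"
      by (subst real_mpoly_eval_superset[OF _ order_refl]) auto
    also have "\<dots> = (\<Sum>u\<in>Poly_Mapping.keys P. Poly_Mapping.lookup P u * real (N u) ^ t)"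
    proof (rule sum.cong[OF refl])
      fix u assume "u \<in> Poly_Mapping.keys P"
      then have "monomial_eval x u = (\<Prod>v\<in>V. x v ^ Poly_Mapping.lookup u v)"
        using fin by (intro monomial_eval_superset) (auto simp: V_def)
      also have "\<dots> = real (N u) ^ t"
        by (simp add: N_def x_def prod_power_distrib flip: power_mult) (simp add: mult.commute)
      finally show "Poly_Mapping.lookup P u * monomial_eval x u = Poly_Mapping.lookup P u * real (N u) ^ t"
        by simp
    qed
    finally show ?thesis by simp
  qed
  from exponential_sum_eq_0[OF finite_keys inj this] show ?thesis
    by (metis in_keys_iff lookup_zero poly_mapping_eqI)
qed

text \<open>Two representations whose denominators do not vanish at \<open>\<rho>\<close> give the
  same value, by evaluating \<open>N * D' = N' * D\<close>; hence the definite description is well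
  defined.\<close>

lemma ratfun_eval_Fract:
  fixes N D :: "('v::linorder, real) mpoly"
  assumes "real_mpoly_eval \<rho> D \<noteq> 0"
  shows "ratfun_eval \<rho> (Fract N D) = real_mpoly_eval \<rho> N / real_mpoly_eval \<rho> D"
  unfolding ratfun_eval_def real_mpoly_eval_def[symmetric]
proof (rule the_equality)
  show "\<exists>N' D'. Fract N D = Fract N' D' \<and> real_mpoly_eval \<rho> D' \<noteq> 0 \<and>
      real_mpoly_eval \<rho> N / real_mpoly_eval \<rho> D = real_mpoly_eval \<rho> N' / real_mpoly_eval \<rho> D'"
    using assms by blast
next
  fix c
  assume "\<exists>N' D'. Fract N D = Fract N' D' \<and> real_mpoly_eval \<rho> D' \<noteq> 0 \<and>
      c = real_mpoly_eval \<rho> N' / real_mpoly_eval \<rho> D'"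
  then obtain N' D' where eq: "Fract N D = Fract N' D'" and D': "real_mpoly_eval \<rho> D' \<noteq> 0"
    and c: "c = real_mpoly_eval \<rho> N' / real_mpoly_eval \<rho> D'"
    by blast
  have "D \<noteq> 0" "D' \<noteq> 0"
    using assms D' by auto
  then have "N * D' = N' * D"
    using eq by (simp add: eq_fract)
  then have "real_mpoly_eval \<rho> N * real_mpoly_eval \<rho> D' = real_mpoly_eval \<rho> N' * real_mpoly_eval \<rho> D"
    by (simp flip: real_mpoly_eval_mult)
  then show "c = real_mpoly_eval \<rho> N / real_mpoly_eval \<rho> D"
    using assms D' c by (simp add: frac_eq_eq)
qed

lemma ratfun_eval_0 [simp]: "ratfun_eval \<rho> 0 = 0"
  by (simp add: Zero_fract_def ratfun_eval_Fract)

section \<open>Degrees of monomials\<close>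

definition monomial_degree :: "('v \<Rightarrow>\<^sub>0 nat) \<Rightarrow> nat" where
  "monomial_degree u = (\<Sum>v\<in>Poly_Mapping.keys u. Poly_Mapping.lookup u v)"

lemma monomial_degree_finite:
  "monomial_degree u = (\<Sum>v\<in>UNIV. Poly_Mapping.lookup u v)" for u :: "'v::finite \<Rightarrow>\<^sub>0 nat"
  unfolding monomial_degree_def by (rule sum.mono_neutral_left) (auto simp: in_keys_iff)

lemma monomial_degree_0 [simp]: "monomial_degree 0 = 0"
  by (simp add: monomial_degree_def)

lemma monomial_degree_single [simp]: "monomial_degree (Poly_Mapping.single v n) = n"
  by (simp add: monomial_degree_def)

lemma monomial_degree_add:
  "monomial_degree (u + w) = monomial_degree u + monomial_degree w" for u w :: "'v::finite \<Rightarrow>\<^sub>0 nat"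
  by (simp add: monomial_degree_finite lookup_add sum.distrib)

section \<open>Laurent sums\<close>

text \<open>Polynomials in the variables \<open>V\<close> divided by powers of \<open>b\<close>,
  seen as functions on \<open>\<rho> b \<noteq> 0\<close>. Functions instead of formal fractions
  allow integrals and derivatives to be treated pointwise in \<open>\<rho>\<close>.\<close>

definition pole_coeffs :: "'v \<Rightarrow> 'v set \<Rightarrow> (('v \<Rightarrow> real) \<Rightarrow> real) set" where
  "pole_coeffs b V = {c. \<exists>N\<in>mpolys V. \<exists>M. \<forall>\<rho>. \<rho> b \<noteq> 0 \<longrightarrow> c \<rho> = real_mpoly_eval \<rho> N / \<rho> b ^ M}"

lemma pole_coeffsI:
  assumes "N \<in> mpolys V" "\<And>\<rho>. \<rho> b \<noteq> 0 \<Longrightarrow> c \<rho> = real_mpoly_eval \<rho> N / \<rho> b ^ M"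
  shows "c \<in> pole_coeffs b V"
  using assms unfolding pole_coeffs_def by blast

lemma pole_coeffs_const: "(\<lambda>\<rho>. r) \<in> pole_coeffs b V"
  by (rule pole_coeffsI[where N = "Poly_Mapping.single 0 r" and M = 0]) auto

lemma pole_coeffs_var: "v \<in> V \<Longrightarrow> (\<lambda>\<rho>. \<rho> v) \<in> pole_coeffs b V"
  by (rule pole_coeffsI[where N = "Poly_Mapping.single (Poly_Mapping.single v 1) 1" and M = 0])
    (auto simp: mpolys_def)

lemma pole_coeffs_inverse: "(\<lambda>\<rho>. 1 / \<rho> b) \<in> pole_coeffs b V"
  by (rule pole_coeffsI[where N = 1 and M = 1]) auto

lemma pole_coeffs_mult:
  assumes "c \<in> pole_coeffs b V" "d \<in> pole_coeffs b V"
  shows "(\<lambda>\<rho>. c \<rho> * d \<rho>) \<in> pole_coeffs b V"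
proof -
  obtain N M N' M' where "N \<in> mpolys V" "N' \<in> mpolys V"
    and "\<And>\<rho>. \<rho> b \<noteq> 0 \<Longrightarrow> c \<rho> = real_mpoly_eval \<rho> N / \<rho> b ^ M"
    and "\<And>\<rho>. \<rho> b \<noteq> 0 \<Longrightarrow> d \<rho> = real_mpoly_eval \<rho> N' / \<rho> b ^ M'"
    using assms unfolding pole_coeffs_def by blast
  then show ?thesis
    by (intro pole_coeffsI[where N = "N * N'" and M = "M + M'"])
      (auto simp: mpolys_mult real_mpoly_eval_mult power_add)
qed

text \<open>
  Finite sums \<open>R\<^sup>-\<^sup>e \<Sum> c(\<rho>) \<phi>(\<theta>) \<eta>\<^sup>u\<close> with \<open>deg u \<le> D\<close>, up to equality for \<open>b \<noteq> 0\<close>, \<open>\<theta> \<ge> 0\<close>, \<open>R > 0\<close>.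
\<close>

inductive laurent ::
    "'v \<Rightarrow> 'v set \<Rightarrow> nat \<Rightarrow> nat \<Rightarrow> (('v \<Rightarrow> real) \<Rightarrow> real \<Rightarrow> real ^ ('d::finite option) \<Rightarrow> real) \<Rightarrow> bool"
  for b V e D where
  laurent_term: "c \<in> pole_coeffs b V \<Longrightarrow> (\<And>T. continuous_on {0..T} \<phi>) \<Longrightarrow> monomial_degree u \<le> D \<Longrightarrow>
    laurent b V e D (\<lambda>\<rho> \<theta> \<eta>. c \<rho> * \<phi> \<theta> * (monomial_eval (($) \<eta>) u / \<eta> $ None ^ e))"
| laurent_add: "laurent b V e D g \<Longrightarrow> laurent b V e D h \<Longrightarrow> laurent b V e D (\<lambda>\<rho> \<theta> \<eta>. g \<rho> \<theta> \<eta> + h \<rho> \<theta> \<eta>)"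
| laurent_cong: "laurent b V e D g \<Longrightarrow>
    (\<And>\<rho> \<theta> \<eta>. \<rho> b \<noteq> 0 \<Longrightarrow> \<theta> \<ge> 0 \<Longrightarrow> \<eta> $ None > 0 \<Longrightarrow> h \<rho> \<theta> \<eta> = g \<rho> \<theta> \<eta>) \<Longrightarrow> laurent b V e D h"

section \<open>Algebraic closure properties of Laurent sums\<close>

lemma laurent_const: "laurent b V 0 D (\<lambda>\<rho> \<theta> \<eta>. r)"
  by (rule laurent_cong[OF laurent_term[OF pole_coeffs_const[of r], of "\<lambda>_. 1" 0]]) auto

lemma laurent_coeff: "c \<in> pole_coeffs b V \<Longrightarrow> laurent b V 0 D (\<lambda>\<rho> \<theta> \<eta>. c \<rho>)"
  by (rule laurent_cong[OF laurent_term[of c _ _ "\<lambda>_. 1" 0]]) auto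

lemma laurent_angle: "(\<And>T. continuous_on {0..T} \<phi>) \<Longrightarrow> laurent b V 0 D (\<lambda>\<rho> \<theta> \<eta>. \<phi> \<theta>)"
  by (rule laurent_cong[OF laurent_term[OF pole_coeffs_const[of 1], of \<phi> 0]]) auto

lemma laurent_var: "D \<ge> 1 \<Longrightarrow> laurent b V 0 D (\<lambda>\<rho> \<theta> \<eta>. \<eta> $ s)"
  by (rule laurent_cong[OF laurent_term[OF pole_coeffs_const[of 1], of "\<lambda>_. 1" "Poly_Mapping.single s 1"]]) auto

lemma laurent_inverse: "laurent b V 1 0 (\<lambda>\<rho> \<theta> \<eta>. 1 / \<eta> $ None)"
  by (rule laurent_cong[OF laurent_term[OF pole_coeffs_const[of 1], of "\<lambda>_. 1" 0]]) auto

text \<open>Numerator and denominator are multiplied by \<open>R ^ (e' - e)\<close>, so a larger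
  pole order costs as many degrees.\<close>

lemma laurent_mono:
  assumes "laurent b V e D g" "e \<le> e'" "D + (e' - e) \<le> D'"
  shows "laurent b V e' D' g"
  using assms(1)
proof induction
  case (laurent_term c \<phi> u)
  let ?u = "u + Poly_Mapping.single None (e' - e)"
  have "laurent b V e' D' (\<lambda>\<rho> \<theta> \<eta>. c \<rho> * \<phi> \<theta> * (monomial_eval (($) \<eta>) ?u / \<eta> $ None ^ e'))"
    using laurent_term assms by (intro laurent.laurent_term) (auto simp: monomial_degree_add)
  then show ?case
    by (rule laurent_cong) (use assms(2) in \<open>auto simp: monomial_eval_add power_diff field_simps\<close>)
next
  case (laurent_cong g h)
  from laurent_cong.IH show ?case
    by (rule laurent.laurent_cong) (simp add: laurent_cong)
qed (rule laurent_add)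

lemma laurent_0: "laurent b V e D (\<lambda>\<rho> \<theta> \<eta>. 0)"
  by (rule laurent_cong[OF laurent_term[OF pole_coeffs_const[of 0], of "\<lambda>_. 1" 0]]) auto

lemma laurent_sum: "(\<And>x. x \<in> A \<Longrightarrow> laurent b V e D (g x)) \<Longrightarrow> laurent b V e D (\<lambda>\<rho> \<theta> \<eta>. \<Sum>x\<in>A. g x \<rho> \<theta> \<eta>)"
  by (induction A rule: infinite_finite_induct) (auto intro: laurent_0 laurent_add)

text \<open>Induction on both factors reduces to a product of two single terms, where pole orders
  and degrees add.\<close>

lemma laurent_mult:
  assumes "laurent b V e D g" "laurent b V e' D' h"
  shows "laurent b V (e + e') (D + D') (\<lambda>\<rho> \<theta> \<eta>. g \<rho> \<theta> \<eta> * h \<rho> \<theta> \<eta>)"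
  using assms(1)
proof induction
  case (laurent_term c \<phi> u)
  from assms(2) show ?case
  proof induction
    case (laurent_term d \<psi> w)
    have "laurent b V (e + e') (D + D') (\<lambda>\<rho> \<theta> \<eta>. (c \<rho> * d \<rho>) * (\<phi> \<theta> * \<psi> \<theta>) *
        (monomial_eval (($) \<eta>) (u + w) / \<eta> $ None ^ (e + e')))"
      using laurent_term \<open>c \<in> _\<close> \<open>\<And>T. continuous_on _ \<phi>\<close> \<open>monomial_degree u \<le> D\<close>
      by (intro laurent.laurent_term continuous_on_mult pole_coeffs_mult) (auto simp: monomial_degree_add)
    then show ?case
      by (rule laurent_cong) (auto simp: monomial_eval_add power_add)
  next
    case (laurent_add g1 g2)
    from laurent.laurent_add[OF laurent_add.IH] show ?case
      by (rule laurent_cong) (simp add: distrib_left)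
  next
    case (laurent_cong g h)
    from laurent_cong.IH show ?case
      by (rule laurent.laurent_cong) (simp add: laurent_cong)
  qed
next
  case (laurent_add g1 g2)
  from laurent.laurent_add[OF laurent_add.IH] show ?case
    by (rule laurent_cong) (simp add: algebra_simps)
next
  case (laurent_cong g1 g2)
  from laurent_cong.IH show ?case
    by (rule laurent.laurent_cong) (simp add: laurent_cong)
qed

lemma laurent_mult_const: "laurent b V e D g \<Longrightarrow> laurent b V e D (\<lambda>\<rho> \<theta> \<eta>. r * g \<rho> \<theta> \<eta>)"
  using laurent_mult[OF laurent_const[of b V 0 r], of e D g] by simp

lemma laurent_diff:
  assumes "laurent b V e D g" "laurent b V e D h"
  shows "laurent b V e D (\<lambda>\<rho> \<theta> \<eta>. g \<rho> \<theta> \<eta> - h \<rho> \<theta> \<eta>)"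
  using laurent_add[OF assms(1) laurent_mult_const[OF assms(2), of "-1"]] by simp

lemma laurent_power:
  assumes "laurent b V 0 D g" shows "laurent b V 0 (n * D) (\<lambda>\<rho> \<theta> \<eta>. g \<rho> \<theta> \<eta> ^ n)"
proof (induction n)
  case (Suc n)
  from laurent_mult[OF assms Suc] show ?case by simp
qed (simp add: laurent_const)

lemma laurent_prod:
  assumes "\<And>x. x \<in> A \<Longrightarrow> laurent b V 0 (D x) (g x)"
  shows "laurent b V 0 (\<Sum>x\<in>A. D x) (\<lambda>\<rho> \<theta> \<eta>. \<Prod>x\<in>A. g x \<rho> \<theta> \<eta>)"
  using assms
proof (induction A rule: infinite_finite_induct)
  case (insert x A)
  then have "laurent b V (0 + 0) (D x + sum D A) (\<lambda>\<rho> \<theta> \<eta>. g x \<rho> \<theta> \<eta> * (\<Prod>x\<in>A. g x \<rho> \<theta> \<eta>))"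
    by (intro laurent_mult) auto
  with insert show ?case by simp
qed (simp_all add: laurent_const)

section \<open>Continuity and integration in the angle\<close>

lemma laurent_continuous:
  assumes "laurent b V e D g" "\<rho> b \<noteq> 0" "\<eta> $ None > 0"
  shows "continuous_on {0..T} (\<lambda>\<theta>. g \<rho> \<theta> \<eta>)"
  using assms(1)
proof induction
  case (laurent_cong g h)
  have "continuous_on {0..T} (\<lambda>\<theta>. h \<rho> \<theta> \<eta>) \<longleftrightarrow> continuous_on {0..T} (\<lambda>\<theta>. g \<rho> \<theta> \<eta>)"
    using assms(2,3) by (intro continuous_on_cong) (auto simp: laurent_cong)
  with laurent_cong.IH show ?case by simp
qed (use assms(3) in \<open>auto intro!: continuous_intros\<close>)

text \<open>In a single term only \<open>\<phi>\<close> depends on the angle, and its integral from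
  0 is again continuous. For sums, \<open>laurent_continuous\<close> supplies the integrability that
  additivity needs.\<close>

lemma laurent_integral:
  assumes "laurent b V e D g"
  shows "laurent b V e D (\<lambda>\<rho> \<theta> \<eta>. integral {0..\<theta>} (\<lambda>\<tau>. g \<rho> \<tau> \<eta>))"
  using assms
proof induction
  case (laurent_term c \<phi> u)
  have "laurent b V e D (\<lambda>\<rho> \<theta> \<eta>. c \<rho> * integral {0..\<theta>} \<phi> * (monomial_eval (($) \<eta>) u / \<eta> $ None ^ e))"
    using laurent_term
    by (intro laurent.laurent_term indefinite_integral_continuous_1 integrable_continuous_real) auto
  then show ?case
    by (rule laurent_cong) simp
next
  case (laurent_add g h)
  from laurent.laurent_add[OF laurent_add.IH] show ?case
  proof (rule laurent_cong)
    fix \<rho> :: "'a \<Rightarrow> real" and \<theta> :: real and \<eta> :: "real ^ 'b option"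
    assume "\<rho> b \<noteq> 0" "\<eta> $ None > 0"
    then have "(\<lambda>\<tau>. g \<rho> \<tau> \<eta>) integrable_on {0..\<theta>}" "(\<lambda>\<tau>. h \<rho> \<tau> \<eta>) integrable_on {0..\<theta>}"
      using laurent_add.hyps by (auto intro: integrable_continuous_real dest: laurent_continuous)
    then show "integral {0..\<theta>} (\<lambda>\<tau>. g \<rho> \<tau> \<eta> + h \<rho> \<tau> \<eta>) =
        integral {0..\<theta>} (\<lambda>\<tau>. g \<rho> \<tau> \<eta>) + integral {0..\<theta>} (\<lambda>\<tau>. h \<rho> \<tau> \<eta>)"
      by (rule Henstock_Kurzweil_Integration.integral_add)
  qed
next
  case (laurent_cong g h)
  from laurent_cong.IH show ?case
    by (rule laurent.laurent_cong)
      (auto intro!: Henstock_Kurzweil_Integration.integral_cong simp: laurent_cong)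
qed

section \<open>Partial derivatives of Laurent sums\<close>

lemma monomial_eval_has_derivative:
  fixes z :: "real ^ ('i::finite)"
  shows "((\<lambda>\<eta>. monomial_eval (($) \<eta>) u) has_derivative
    (\<lambda>w. \<Sum>s\<in>UNIV. w $ s * (Poly_Mapping.lookup u s *
        monomial_eval (($) z) (u - Poly_Mapping.single s 1)))) (at z)"
proof -
  have "((\<lambda>\<eta>. \<Prod>s\<in>UNIV. \<eta> $ s ^ Poly_Mapping.lookup u s) has_derivative
      (\<lambda>w. \<Sum>s\<in>UNIV. (w $ s * (Poly_Mapping.lookup u s * z $ s ^ (Poly_Mapping.lookup u s - 1))) *
         (\<Prod>t\<in>UNIV - {s}. z $ t ^ Poly_Mapping.lookup u t))) (at z)"
    by (rule has_derivative_prod) (auto intro!: derivative_eq_intros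
      bounded_linear_imp_has_derivative bounded_linear_vec_nth simp: mult_ac)
  \<comment> \<open>Both subtractions truncate alike, so this includes exponent 0, where the factor
    \<open>Poly_Mapping.lookup u s\<close> removes the term from the gradient.\<close>
  moreover have "z $ s ^ (Poly_Mapping.lookup u s - 1) * (\<Prod>t\<in>UNIV - {s}. z $ t ^ Poly_Mapping.lookup u t) =
      monomial_eval (($) z) (u - Poly_Mapping.single s 1)" for s
    by (simp add: monomial_eval_finite prod.remove[of UNIV s] lookup_minus lookup_single when_def)
  ultimately show ?thesis
    by (simp add: monomial_eval_finite[abs_def] mult.assoc)
qed

text \<open>The quotient rule for \<open>\<eta>\<^sup>u / R\<^sup>e\<close> yields a term of type
  \<open>(e, D - 1)\<close>, raised to \<open>(e + 1, D)\<close> by a factor R, and, in the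
  direction of R, a second one with denominator \<open>R\<^sup>e\<^sup>+\<^sup>1\<close>. The
  functions \<open>G s\<close> are chosen before \<open>\<rho>\<close>, \<open>\<theta>\<close> and
  \<open>z\<close>, so that they are Laurent sums again and differentiation can be iterated.\<close>

lemma laurent_has_derivative:
  fixes g :: "('v \<Rightarrow> real) \<Rightarrow> real \<Rightarrow> real ^ ('d::finite option) \<Rightarrow> real"
  assumes "laurent b V e D g"
  shows "\<exists>G. (\<forall>s. laurent b V (Suc e) D (G s)) \<and> (\<forall>\<rho> \<theta> z. \<rho> b \<noteq> 0 \<longrightarrow> \<theta> \<ge> 0 \<longrightarrow> z $ None > 0 \<longrightarrow>
    (g \<rho> \<theta> has_derivative (\<lambda>w. \<Sum>s\<in>UNIV. w $ s * G s \<rho> \<theta> z)) (at z))"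
  using assms
proof induction
  case (laurent_term c \<phi> u)
  define G where "G s = (\<lambda>\<rho> \<theta> (z :: real ^ 'd option).
      Poly_Mapping.lookup u s *
        (c \<rho> * \<phi> \<theta> * (monomial_eval (($) z) (u - Poly_Mapping.single s 1) / z $ None ^ e)) +
      (if s = None then - real e else 0) * (c \<rho> * \<phi> \<theta> * (monomial_eval (($) z) u / z $ None ^ Suc e)))" for s
  have "laurent b V (Suc e) D (\<lambda>\<rho> \<theta> z. Poly_Mapping.lookup u s *
        (c \<rho> * \<phi> \<theta> * (monomial_eval (($) z) (u - Poly_Mapping.single s 1) / z $ None ^ e)))" for s
  \<comment> \<open>If the exponent is 0, the coefficient vanishes. Otherwise the degree drops by
    one, which pays for the larger pole order.\<close>
  proof (cases "Poly_Mapping.lookup u s = 0")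
    case False
    have "u = (u - Poly_Mapping.single s 1) + Poly_Mapping.single s 1"
      using False by (auto intro!: poly_mapping_eqI simp: lookup_add lookup_minus lookup_single when_def)
    then have "monomial_degree u = monomial_degree (u - Poly_Mapping.single s 1) + 1"
      by (metis monomial_degree_add monomial_degree_single)
    then have deg: "monomial_degree (u - Poly_Mapping.single s 1) \<le> D - 1" and "D \<ge> 1"
      using laurent_term(3) by auto
    from laurent.laurent_term[OF laurent_term(1,2) deg, of e] \<open>D \<ge> 1\<close> show ?thesis
      by (intro laurent_mult_const) (rule laurent_mono, auto)
  qed (simp add: laurent_0)
  then have "laurent b V (Suc e) D (G s)" for s
    unfolding G_def
    by (rule laurent_add[OF _ laurent_mult_const[OF laurent.laurent_term[OF laurent_term]]])
  moreover have "((\<lambda>\<eta>. c \<rho> * \<phi> \<theta> * (monomial_eval (($) \<eta>) u / \<eta> $ None ^ e)) has_derivative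
      (\<lambda>w. \<Sum>s\<in>UNIV. w $ s * G s \<rho> \<theta> z)) (at z)" if "z $ None > 0" for \<rho> \<theta> and z :: "real ^ 'd option"
  proof -
    have "((\<lambda>r. inverse (r ^ e)) has_real_derivative - real e / z $ None ^ Suc e) (at (z $ None))"
    proof -
      have "((\<lambda>r. inverse (r ^ e)) has_real_derivative
          - (real e * z $ None ^ (e - 1) / (z $ None ^ e * z $ None ^ e))) (at (z $ None))"
        using that by (auto intro!: derivative_eq_intros simp: divide_inverse mult_ac)
      also have "real e * z $ None ^ (e - 1) / (z $ None ^ e * z $ None ^ e) = real e / z $ None ^ Suc e"
        using that by (cases e) (auto simp: divide_simps)
      finally show ?thesis by simp
    qed
    from DERIV_compose_FDERIV[where f = "\<lambda>r. inverse (r ^ e)" and g = "\<lambda>\<eta>. \<eta> $ None", OF this]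
    have "((\<lambda>\<eta>. inverse (\<eta> $ None ^ e)) has_derivative
        (\<lambda>w. w $ None * (- real e / z $ None ^ Suc e))) (at z)"
      using bounded_linear_imp_has_derivative[OF bounded_linear_vec_nth] by blast
    note deriv = has_derivative_mult_right
      [OF has_derivative_mult[OF monomial_eval_has_derivative[of u z] this], of "c \<rho> * \<phi> \<theta>"]
    have "(\<Sum>s\<in>UNIV. w $ s * G s \<rho> \<theta> z) = c \<rho> * \<phi> \<theta> *
        (monomial_eval (($) z) u * (w $ None * (- real e / z $ None ^ Suc e)) +
        (\<Sum>s\<in>UNIV. w $ s * (Poly_Mapping.lookup u s * monomial_eval (($) z) (u - Poly_Mapping.single s 1)))
          * inverse (z $ None ^ e))" for w :: "real ^ 'd option"
    proof -
      have "(\<Sum>s\<in>UNIV. w $ s * G s \<rho> \<theta> z) =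
          (\<Sum>s\<in>UNIV. if s = None
            then w $ s * (- real e * (c \<rho> * \<phi> \<theta> * (monomial_eval (($) z) u / z $ None ^ Suc e))) else 0) +
          (\<Sum>s\<in>UNIV. c \<rho> * \<phi> \<theta> * (w $ s * (Poly_Mapping.lookup u s *
            monomial_eval (($) z) (u - Poly_Mapping.single s 1)) * inverse (z $ None ^ e)))"
        unfolding sum.distrib[symmetric]
        by (rule sum.cong) (auto simp: G_def divide_inverse distrib_left mult_ac)
      also have "\<dots> = c \<rho> * \<phi> \<theta> * (monomial_eval (($) z) u * (w $ None * (- real e / z $ None ^ Suc e))) +
          c \<rho> * \<phi> \<theta> * ((\<Sum>s\<in>UNIV. w $ s * (Poly_Mapping.lookup u s *
            monomial_eval (($) z) (u - Poly_Mapping.single s 1))) * inverse (z $ None ^ e))"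
        by (simp add: sum_distrib_left sum_distrib_right mult_ac)
      finally show ?thesis
        by (simp only: distrib_left)
    qed
    with deriv show ?thesis
      by (simp only: divide_inverse[of "monomial_eval _ _"])
  qed
  ultimately show ?case
    by blast
next
  case (laurent_add g h)
  obtain G where G: "\<forall>s. laurent b V (Suc e) D (G s)"
    "\<forall>\<rho> \<theta> z. \<rho> b \<noteq> 0 \<longrightarrow> \<theta> \<ge> 0 \<longrightarrow> z $ None > 0 \<longrightarrow>
      (g \<rho> \<theta> has_derivative (\<lambda>w. \<Sum>s\<in>UNIV. w $ s * G s \<rho> \<theta> z)) (at z)"
    using laurent_add.IH(1) by (elim exE conjE)
  obtain H where H: "\<forall>s. laurent b V (Suc e) D (H s)"
    "\<forall>\<rho> \<theta> z. \<rho> b \<noteq> 0 \<longrightarrow> \<theta> \<ge> 0 \<longrightarrow> z $ None > 0 \<longrightarrow>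
      (h \<rho> \<theta> has_derivative (\<lambda>w. \<Sum>s\<in>UNIV. w $ s * H s \<rho> \<theta> z)) (at z)"
    using laurent_add.IH(2) by (elim exE conjE)
  have "laurent b V (Suc e) D (\<lambda>\<rho> \<theta> z. G s \<rho> \<theta> z + H s \<rho> \<theta> z)" for s
    using G(1) H(1) by (intro laurent.laurent_add) auto
  moreover have "((\<lambda>z. g \<rho> \<theta> z + h \<rho> \<theta> z) has_derivative
      (\<lambda>w. \<Sum>s\<in>UNIV. w $ s * (G s \<rho> \<theta> z + H s \<rho> \<theta> z))) (at z)"
    if "\<rho> b \<noteq> 0" "\<theta> \<ge> 0" "z $ None > 0" for \<rho> \<theta> z
    unfolding distrib_left sum.distrib using G(2) H(2) that by (intro has_derivative_add) auto
  ultimately show ?case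
    by (intro exI[of _ "\<lambda>s \<rho> \<theta> z. G s \<rho> \<theta> z + H s \<rho> \<theta> z"]) simp
next
  case (laurent_cong g h)
  \<comment> \<open>The two functions are known to agree only for R > 0; this half-space is open, so
    the derivative carries over.\<close>
  have open_pos: "open {z :: real ^ 'd option. z $ None > 0}"
    by (intro open_Collect_less continuous_intros)
  obtain G where G: "\<forall>s. laurent b V (Suc e) D (G s)"
    "\<forall>\<rho> \<theta> z. \<rho> b \<noteq> 0 \<longrightarrow> \<theta> \<ge> 0 \<longrightarrow> z $ None > 0 \<longrightarrow>
      (g \<rho> \<theta> has_derivative (\<lambda>w. \<Sum>s\<in>UNIV. w $ s * G s \<rho> \<theta> z)) (at z)"
    using laurent_cong.IH by (elim exE conjE)
  have "(h \<rho> \<theta> has_derivative (\<lambda>w. \<Sum>s\<in>UNIV. w $ s * G s \<rho> \<theta> z)) (at z)"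
    if "\<rho> b \<noteq> 0" "\<theta> \<ge> 0" "z $ None > 0" for \<rho> \<theta> z
    by (rule has_derivative_transform_within_open[OF _ open_pos])
      (use G(2) that laurent_cong.hyps in auto)
  with G(1) show ?case
    by (intro exI[of _ G]) simp
qed

section \<open>Taylor coefficients of the standard form\<close>

text \<open>In the recursion for the Taylor coefficients the \<open>l\<close>-th term has type
  \<open>(l, (l + 1) m)\<close>. Raising its pole order to \<open>i - 1\<close> costs
  \<open>i - 1 - l\<close> degrees, at most \<open>(i - 1 - l) m\<close>. The case
  \<open>l = 0\<close> covers the term without lower coefficients.\<close>

lemma Suc_mult_add_diff_le: "l < i \<Longrightarrow> m \<ge> 1 \<Longrightarrow> Suc l * m + (i - 1 - l) \<le> i * m" for l i m :: nat
proof -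
  assume "l < i" "m \<ge> 1"
  define d where "d = i - Suc l"
  have i: "i = Suc l + d"
    using \<open>l < i\<close> by (simp add: d_def)
  have "d * 1 \<le> d * m"
    using \<open>m \<ge> 1\<close> by (intro mult_le_mono2)
  then show ?thesis
    unfolding i by (simp add: distrib_right)
qed

section \<open>Taylor coefficients of a quotient\<close>

lemma has_fps_expansion_nth:
  fixes f :: "real \<Rightarrow> real"
  assumes "f has_fps_expansion F"
  shows "(deriv ^^ n) f 0 / fact n = fps_nth F n"
proof -
  have "(deriv ^^ n) f 0 = fact n * fps_nth F n"
    using assms
  proof (induction n arbitrary: f F)
    case 0
    then have "f 0 = eval_fps F 0"
      unfolding has_fps_expansion_def by (auto dest: eventually_nhds_x_imp_x)
    then show ?case
      by (simp add: eval_fps_at_0)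
  next
    case (Suc n)
    \<comment> \<open>Splitting off the innermost derivative lets the induction hypothesis apply to
      \<open>deriv f\<close> and its expansion.\<close>
    have "(deriv ^^ Suc n) f 0 = (deriv ^^ n) (deriv f) 0"
      by (simp only: funpow_Suc_right o_apply)
    also have "\<dots> = fact (Suc n) * fps_nth F (Suc n)"
      by (simp add: Suc.IH[OF has_fps_expansion_deriv[OF Suc.prems]])
    finally show ?case .
  qed
  then show ?thesis
    by simp
qed

text \<open>Multiply by the denominator, which is an invertible power series because
  \<open>d \<noteq> 0\<close>, and compare coefficients. For \<open>i\<close> in this range the
  truncation at \<open>k\<close> leaves \<open>A i\<close> and all the \<open>B (i - l)\<close> in
  place.\<close>

lemma taylor_coeff_quotient:
  fixes A B :: "nat \<Rightarrow> real" and d :: real and k :: nat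
  defines "f \<equiv> \<lambda>\<epsilon>. (\<Sum>i=1..k. \<epsilon> ^ i * A i) / (d + (\<Sum>i=1..k. \<epsilon> ^ i * B i))"
  defines "a \<equiv> \<lambda>i. (deriv ^^ i) f 0 / fact i"
  assumes "d \<noteq> 0" and i: "i \<in> {1..k}"
  shows "d * a i = A i - (\<Sum>l\<in>{1..<i}. a l * B (i - l))"
proof -
  define P where "P C = (\<Sum>i=1..k. fps_X ^ i * fps_const (C i))" for C :: "nat \<Rightarrow> real"
  have nth_P: "fps_nth (P C) i = (if i \<in> {1..k} then C i else 0)" for C i
  proof -
    have "fps_nth (P C) i = (\<Sum>l=1..k. if i = l then C l else 0)"
      unfolding P_def fps_sum_nth by (rule sum.cong) (auto simp: fps_X_power_nth)
    then show ?thesis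
      by simp
  qed
  have exp_P: "(\<lambda>\<epsilon>. \<Sum>i=1..k. \<epsilon> ^ i * C i) has_fps_expansion P C" for C
    unfolding P_def by (intro fps_expansion_intros)
  let ?D = "fps_const d + P B"
  have D0: "fps_nth ?D 0 = d"
    by (simp add: nth_P)
  have "f has_fps_expansion P A / ?D"
    unfolding f_def using \<open>d \<noteq> 0\<close> D0 exp_P by (intro has_fps_expansion_divide' fps_expansion_intros) auto
  then have a: "fps_nth (P A / ?D) l = a l" for l
    by (simp add: a_def has_fps_expansion_nth)
  \<comment> \<open>The numerator has no constant term; this removes \<open>l = 0\<close> from the
    convolution below.\<close>
  have a0: "a 0 = 0"
    by (simp add: a_def f_def power_0_left sum.neutral)
  have "?D \<noteq> 0" "subdegree ?D = 0"
    using D0 \<open>d \<noteq> 0\<close> by (metis fps_zero_nth, metis subdegree_eq_0)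
  then have "P A = P A / ?D * ?D"
    by (simp add: fps_times_divide_eq)
  then have "A i = fps_nth (P A / ?D * ?D) i"
    using i by (metis nth_P)
  also have "\<dots> = (\<Sum>l=0..i. a l * fps_nth ?D (i - l))"
    by (simp add: fps_mult_nth a)
  also have "\<dots> = (\<Sum>l\<in>insert i {1..<i}. a l * fps_nth ?D (i - l))"
    using i a0 by (intro sum.mono_neutral_right) (auto simp: Suc_le_eq)
  also have "\<dots> = d * a i + (\<Sum>l\<in>{1..<i}. a l * B (i - l))"
    using i by (subst sum.insert) (auto simp: nth_P intro!: sum.cong)
  finally show ?thesis
    by simp
qed

section \<open>Types of the functions in the standard form\<close>

lemma laurent_sf_monom:
  "laurent b V 0 (\<Sum>x\<in>UNIV. \<iota> x) (\<lambda>\<rho> \<theta> \<eta>. sf_monom \<theta> \<eta> \<iota>)" for \<iota> :: "'d::finite coord \<Rightarrow> nat"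
proof -
  have polar: "laurent b V 0 (n * 1) (\<lambda>\<rho> \<theta> (\<eta> :: real ^ 'd option). (\<eta> $ None * \<phi> \<theta>) ^ n)"
    if "\<And>T. continuous_on {0..T} \<phi>" for n and \<phi> :: "real \<Rightarrow> real"
  proof (rule laurent_power)
    show "laurent b V 0 1 (\<lambda>\<rho> \<theta> (\<eta> :: real ^ 'd option). \<eta> $ None * \<phi> \<theta>)"
      using laurent_mult[OF laurent_var[of 1 _ _ None] laurent_angle[OF that, where D = 0]] by simp
  qed
  have "laurent b V 0 (\<Sum>s\<in>UNIV. \<iota> (Xs s) * 1)
      (\<lambda>\<rho> \<theta> (\<eta> :: real ^ 'd option). \<Prod>s\<in>UNIV. \<eta> $ Some s ^ \<iota> (Xs s))"
    by (intro laurent_prod laurent_power laurent_var) simp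
  from laurent_mult[OF laurent_mult[OF polar polar] this, of cos sin "\<iota> X1" "\<iota> X2"]
  have "laurent b V 0 (\<iota> X1 + \<iota> X2 + (\<Sum>s\<in>UNIV. \<iota> (Xs s))) (\<lambda>\<rho> \<theta> \<eta>. sf_monom \<theta> \<eta> \<iota>)"
    by (simp add: sf_monom_def[abs_def] continuous_intros)
  also have "\<iota> X1 + \<iota> X2 + (\<Sum>s\<in>UNIV. \<iota> (Xs s)) = (\<Sum>x\<in>UNIV. \<iota> x)"
    by (simp add: UNIV_coord sum.reindex inj_on_def image_iff add.assoc)
  finally show ?thesis .
qed

lemma laurent_sf_sum:
  fixes g :: "('d::finite coord \<Rightarrow> nat) \<Rightarrow> ('v \<Rightarrow> real) \<Rightarrow> real \<Rightarrow> real"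
  assumes "\<And>\<iota>. \<iota> \<in> exponents m \<Longrightarrow> laurent b V 0 0 (\<lambda>\<rho> \<theta> (\<eta> :: real ^ 'd option). g \<iota> \<rho> \<theta>)"
  shows "laurent b V 0 m (\<lambda>\<rho> \<theta> \<eta>. \<Sum>\<iota>\<in>exponents m. g \<iota> \<rho> \<theta> * sf_monom \<theta> \<eta> \<iota>)"
proof (rule laurent_sum)
  fix \<iota> :: "'d coord \<Rightarrow> nat" assume "\<iota> \<in> exponents m"
  then show "laurent b V 0 m (\<lambda>\<rho> \<theta> \<eta>. g \<iota> \<rho> \<theta> * sf_monom \<theta> \<eta> \<iota>)"
    using laurent_mult[OF assms laurent_sf_monom, of \<iota> \<iota>] by (simp add: exponents_def)
qed

lemma laurent_param: "v \<in> V \<Longrightarrow> laurent b V 0 D (\<lambda>\<rho> \<theta> \<eta>. \<rho> v)"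
  by (rule laurent_coeff[OF pole_coeffs_var])

lemma laurent_param_angle:
  "v \<in> V \<Longrightarrow> (\<And>T. continuous_on {0..T} \<phi>) \<Longrightarrow> laurent b V 0 0 (\<lambda>\<rho> \<theta> \<eta>. \<rho> v * \<phi> \<theta>)"
  using laurent_mult[OF laurent_param laurent_angle, of v V \<phi> b 0 0] by simp

lemma laurent_param_var:
  "v \<in> V \<Longrightarrow> m \<ge> 1 \<Longrightarrow> laurent b V 0 m (\<lambda>\<rho> \<theta> \<eta>. \<rho> v * \<eta> $ s)"
  using laurent_mult[OF laurent_param laurent_var, of v V m b 0 s] by simp

context
  fixes m k i :: nat
  assumes m: "m \<ge> 1" and i: "i \<in> {1..k}"
begin

text \<open>The range of \<open>i\<close> places \<open>PA i\<close> and the coefficients with power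
  \<open>i - 1 < k\<close> in \<open>params m k\<close>; the next two lemmas rely on it
  likewise.\<close>

lemma laurent_S1: "laurent PB (params m k) 0 m (\<lambda>\<rho> \<theta> \<eta>. S1 \<rho> m i \<theta> \<eta>)"
  unfolding S1_def using m i
  by (intro laurent_add laurent_sf_sum laurent_param_angle laurent_param_var)
    (auto simp: params_def intro!: continuous_intros)

lemma laurent_S2: "laurent PB (params m k) 0 m (\<lambda>\<rho> \<theta> \<eta>. S2 \<rho> m i \<theta> \<eta>)"
  unfolding S2_def using m i
  by (intro laurent_add laurent_diff laurent_sf_sum laurent_param_angle laurent_param_var)
    (auto simp: params_def intro!: continuous_intros)

lemma laurent_Ss: "laurent PB (params m k) 0 m (\<lambda>\<rho> \<theta> \<eta>. Ss \<rho> m s i \<theta> \<eta>)"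
  unfolding Ss_def using m i
  by (intro laurent_add laurent_sf_sum laurent_param laurent_param_var)
    (auto simp: params_def)

end

text \<open>Strong induction: \<open>taylor_coeff_quotient\<close> with \<open>d = b R\<close>
  expresses the coefficient through lower ones. Dividing by \<open>b R\<close> adds one pole order
  to each product, and 1 / b is an admissible coefficient.\<close>

lemma laurent_sf_coeff:
  fixes j :: "'d::finite option"
  assumes m: "m \<ge> 1" and "i \<in> {1..k}"
  shows "laurent PB (params m k) (i - 1) (i * m) (\<lambda>\<rho> \<theta> \<eta>. sf_coeff \<rho> m k i \<theta> \<eta> $ j)"
  using assms(2)
proof (induction i rule: less_induct)
  case (less i)
  define S where "S i = (\<lambda>\<rho> \<theta> (\<eta> :: real ^ 'd option).
    case j of None \<Rightarrow> S1 \<rho> m i \<theta> \<eta> | Some s \<Rightarrow> Ss \<rho> m s i \<theta> \<eta>)" for i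
  have "laurent PB (params m k) 0 m (S i)"
    unfolding S_def using laurent_S1[OF m less.prems] laurent_Ss[OF m less.prems] by (cases j) auto
  from laurent_mult[OF laurent_coeff[OF pole_coeffs_inverse, of PB _ 0] this]
  have "laurent PB (params m k) (i - 1) (i * m) (\<lambda>\<rho> \<theta> \<eta>. 1 / \<rho> PB * S i \<rho> \<theta> \<eta>)"
    by (rule laurent_mono) (use Suc_mult_add_diff_le[of 0 i m] m less.prems in auto)
  moreover have "laurent PB (params m k) (i - 1) (i * m)
      (\<lambda>\<rho> \<theta> \<eta>. 1 / \<rho> PB * (1 / \<eta> $ None * (sf_coeff \<rho> m k l \<theta> \<eta> $ j * S2 \<rho> m (i - l) \<theta> \<eta>)))"
    if l: "l \<in> {1..<i}" for l
  proof -
    have "l < i" "l \<in> {1..k}" "i - l \<in> {1..k}"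
      using l less.prems by auto
    \<comment> \<open>The pole order is \<open>l\<close>: \<open>l - 1\<close> from the lower
      coefficient and 1 from the division by R.\<close>
    from laurent_mult[OF laurent_coeff[OF pole_coeffs_inverse, of PB _ 0]
        laurent_mult[OF laurent_inverse laurent_mult[OF less.IH[OF this(1,2)] laurent_S2[OF m this(3)]]]]
    show ?thesis
      by (rule laurent_mono) (use Suc_mult_add_diff_le[of l i m] m l in auto)
  qed
  ultimately have "laurent PB (params m k) (i - 1) (i * m)
      (\<lambda>\<rho> \<theta> \<eta>. 1 / \<rho> PB * S i \<rho> \<theta> \<eta> - (\<Sum>l\<in>{1..<i}.
        1 / \<rho> PB * (1 / \<eta> $ None * (sf_coeff \<rho> m k l \<theta> \<eta> $ j * S2 \<rho> m (i - l) \<theta> \<eta>))))"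
    by (intro laurent_diff laurent_sum)
  then show ?case
  proof (rule laurent_cong)
    fix \<rho> :: "'d param \<Rightarrow> real" and \<theta> :: real and \<eta> :: "real ^ 'd option"
    assume nz: "\<rho> PB \<noteq> 0" "\<eta> $ None > 0"
    \<comment> \<open>The factor R moves into each numerator coefficient, which gives the shape that
      \<open>taylor_coeff_quotient\<close> expects.\<close>
    have rhs: "sf_rhs \<rho> m k j \<theta> \<eta> = (\<lambda>\<epsilon>. (\<Sum>i=1..k. \<epsilon> ^ i * (\<eta> $ None * S i \<rho> \<theta> \<eta>)) /
        (\<rho> PB * \<eta> $ None + (\<Sum>i=1..k. \<epsilon> ^ i * S2 \<rho> m i \<theta> \<eta>)))"
      by (rule ext) (simp add: sf_rhs_def S_def sum_distrib_left mult_ac)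
    have "\<rho> PB * \<eta> $ None * sf_coeff \<rho> m k i \<theta> \<eta> $ j = \<eta> $ None * S i \<rho> \<theta> \<eta> -
        (\<Sum>l\<in>{1..<i}. sf_coeff \<rho> m k l \<theta> \<eta> $ j * S2 \<rho> m (i - l) \<theta> \<eta>)"
      unfolding sf_coeff_def vec_lambda_beta rhs using nz less.prems
      by (intro taylor_coeff_quotient) auto
    then have "sf_coeff \<rho> m k i \<theta> \<eta> $ j = (\<eta> $ None * S i \<rho> \<theta> \<eta> -
        (\<Sum>l\<in>{1..<i}. sf_coeff \<rho> m k l \<theta> \<eta> $ j * S2 \<rho> m (i - l) \<theta> \<eta>)) / (\<rho> PB * \<eta> $ None)"
      using nz by (simp add: field_simps)
    also have "\<dots> = 1 / \<rho> PB * S i \<rho> \<theta> \<eta> - (\<Sum>l\<in>{1..<i}.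
        1 / \<rho> PB * (1 / \<eta> $ None * (sf_coeff \<rho> m k l \<theta> \<eta> $ j * S2 \<rho> m (i - l) \<theta> \<eta>)))"
      using nz by (simp add: diff_divide_distrib sum_divide_distrib)
    finally show "sf_coeff \<rho> m k i \<theta> \<eta> $ j = \<dots>" .
  qed
qed

section \<open>Averaged functions\<close>

text \<open>A multilinear form given by its entries: the sum over all index words
  \<open>[s1, ..., sL]\<close> of \<open>w1 $ s1 * ... * wL $ sL * G [s1, ..., sL]\<close>. The
  entries will be iterated partial derivatives.\<close>

fun contract :: "('i::finite list \<Rightarrow> real) \<Rightarrow> (real ^ 'i) list \<Rightarrow> real" where
  "contract G [] = G []"
| "contract G (w # ws) = (\<Sum>s\<in>UNIV. w $ s * contract (\<lambda>c. G (s # c)) ws)"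

lemma contract_sum: "contract (\<lambda>c. \<Sum>s\<in>A. a s * G s c) ws = (\<Sum>s\<in>A. a s * contract (G s) ws)"
proof (induction ws arbitrary: G)
  case (Cons w ws)
  show ?case
    by (simp add: Cons.IH sum_distrib_left mult_ac) (rule sum.swap)
qed simp

text \<open>For fixed vectors a contraction is a fixed linear combination of the entries, so it is
  differentiated entrywise.\<close>

lemma contract_has_derivative:
  assumes "\<And>c. length c = length ws \<Longrightarrow> (G c has_derivative G' c) F"
  shows "((\<lambda>z. contract (\<lambda>c. G c z) ws) has_derivative (\<lambda>w. contract (\<lambda>c. G' c w) ws)) F"
  using assms
proof (induction ws arbitrary: G G')
  case (Cons v ws)
  show ?case
    unfolding contract.simps
    by (intro has_derivative_sum has_derivative_mult_right Cons.IH) (simp add: Cons.prems)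
qed simp

lemma has_derivative_vec_lambda:
  fixes f :: "'i::finite \<Rightarrow> 'a::real_normed_vector \<Rightarrow> real"
  assumes "\<And>j. (f j has_derivative f' j) (at x)"
  shows "((\<lambda>x. \<chi> j. f j x) has_derivative (\<lambda>w. \<chi> j. f' j w)) (at x)"
proof (subst has_derivative_componentwise_within, rule ballI)
  fix i :: "real ^ 'i" assume "i \<in> Basis"
  then obtain j where "i = axis j 1"
    by (auto simp: Basis_vec_def)
  then show "((\<lambda>x. (\<chi> j. f j x) \<bullet> i) has_derivative (\<lambda>w. (\<chi> j. f' j w) \<bullet> i)) (at x)"
    using assms[of j] by (simp add: inner_axis)
qed

text \<open>Each further derivative replaces the entries by their gradients, which by
  \<open>laurent_has_derivative\<close> raises the pole order by one and keeps the degree bound. The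
  entries do not depend on the argument vectors.\<close>

lemma iter_frechet_laurent:
  fixes f :: "('v \<Rightarrow> real) \<Rightarrow> real \<Rightarrow> real ^ ('d::finite option) \<Rightarrow> real ^ ('d option)"
  assumes "\<And>j. laurent b V e D (\<lambda>\<rho> \<theta> \<eta>. f \<rho> \<theta> \<eta> $ j)"
  shows "\<exists>G. (\<forall>j c. length c = L \<longrightarrow> laurent b V (e + L) D (G j c)) \<and>
    (\<forall>\<rho> \<theta> z ws j. \<rho> b \<noteq> 0 \<longrightarrow> \<theta> \<ge> 0 \<longrightarrow> z $ None > 0 \<longrightarrow> length ws = L \<longrightarrow>
      iter_frechet (f \<rho> \<theta>) z ws $ j = contract (\<lambda>c. G j c \<rho> \<theta> z) ws)"
proof (induction L)
  case 0
  show ?case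
    by (rule exI[of _ "\<lambda>j c \<rho> \<theta> z. f \<rho> \<theta> z $ j"]) (simp add: assms)
next
  case (Suc L)
  then obtain G where G: "\<And>j c. length c = L \<Longrightarrow> laurent b V (e + L) D (G j c)"
    and iter: "\<And>\<rho> \<theta> z ws j. \<rho> b \<noteq> 0 \<Longrightarrow> \<theta> \<ge> 0 \<Longrightarrow> z $ None > 0 \<Longrightarrow> length ws = L \<Longrightarrow>
      iter_frechet (f \<rho> \<theta>) z ws $ j = contract (\<lambda>c. G j c \<rho> \<theta> z) ws"
    by blast
  \<comment> \<open>Every entry has some gradient; choice makes it a function of the component and
    the index word, as the next tensor requires.\<close>
  define is_grad where "is_grad j c H \<longleftrightarrow> (\<forall>s. laurent b V (Suc (e + L)) D (H s)) \<and>
    (\<forall>\<rho> \<theta> z. \<rho> b \<noteq> 0 \<longrightarrow> \<theta> \<ge> 0 \<longrightarrow> z $ None > 0 \<longrightarrow>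
      (G j c \<rho> \<theta> has_derivative (\<lambda>w. \<Sum>s\<in>UNIV. w $ s * H s \<rho> \<theta> z)) (at z))" for j c H
  define H where "H j c = (SOME H. is_grad j c H)" for j c
  have H: "is_grad j c (H j c)" if "length c = L" for j c
    unfolding H_def by (rule someI_ex[of "is_grad j c"])
      (unfold is_grad_def, rule laurent_has_derivative[OF G[OF that]])
  have H_deriv: "(G j c \<rho> \<theta> has_derivative (\<lambda>w. \<Sum>s\<in>UNIV. w $ s * H j c s \<rho> \<theta> z)) (at z)"
    if "length c = L" "\<rho> b \<noteq> 0" "\<theta> \<ge> 0" "z $ None > 0" for j c \<rho> \<theta> z
    using H[OF that(1)] that(2-4) unfolding is_grad_def by blast
  have open_pos: "open {z :: real ^ 'd option. z $ None > 0}"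
    by (intro open_Collect_less continuous_intros)
  show ?case
  \<comment> \<open>\<open>iter_frechet\<close> differentiates last in the direction at the head of
    the list, so the newest index is the head of the word.\<close>
  proof (intro exI[of _ "\<lambda>j c. H j (tl c) (hd c)"] conjI allI impI)
    fix j and c :: "'d option list" assume "length c = Suc L"
    then have "length (tl c) = L"
      by simp
    from H[OF this] show "laurent b V (e + Suc L) D (H j (tl c) (hd c))"
      by (simp add: is_grad_def)
  next
    fix \<rho> :: "'v \<Rightarrow> real" and \<theta> :: real and z :: "real ^ 'd option" and ws :: "(real ^ 'd option) list" and j
    assume dom: "\<rho> b \<noteq> 0" "\<theta> \<ge> 0" "z $ None > 0" and "length ws = Suc L"
    then obtain v vs where ws: "ws = v # vs" "length vs = L"
      by (cases ws) auto
    have "((\<lambda>z. \<chi> j. contract (\<lambda>c. G j c \<rho> \<theta> z) vs) has_derivative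
        (\<lambda>w. \<chi> j. contract (\<lambda>c. \<Sum>s\<in>UNIV. w $ s * H j c s \<rho> \<theta> z) vs)) (at z)"
      by (rule has_derivative_vec_lambda, rule contract_has_derivative, rule H_deriv) (use dom ws(2) in auto)
    then have "((\<lambda>z. iter_frechet (f \<rho> \<theta>) z vs) has_derivative
        (\<lambda>w. \<chi> j. contract (\<lambda>c. \<Sum>s\<in>UNIV. w $ s * H j c s \<rho> \<theta> z) vs)) (at z)"
      by (rule has_derivative_transform_within_open[OF _ open_pos])
        (use dom(1,2,3) in \<open>simp_all add: vec_eq_iff iter[of \<rho>, OF dom(1,2) _ ws(2)]\<close>)
    then have "iter_frechet (f \<rho> \<theta>) z ws $ j = contract (\<lambda>c. \<Sum>s\<in>UNIV. v $ s * H j c s \<rho> \<theta> z) vs"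
      by (simp add: ws(1) frechet_derivative_at[symmetric])
    then show "iter_frechet (f \<rho> \<theta>) z ws $ j = contract (\<lambda>c. H j (tl c) (hd c) \<rho> \<theta> z) ws"
      by (simp add: ws(1) contract_sum)
  qed
qed

text \<open>The form is linear in each argument, so every occurrence of an index in
  \<open>js\<close> contributes its pole order and degree once.\<close>

lemma contract_laurent:
  assumes "\<And>c. length c = length js \<Longrightarrow> laurent b V e D (G c)"
    and "\<And>j s. j \<in> set js \<Longrightarrow> laurent b V (p j) (q j) (\<lambda>\<rho> \<theta> \<eta>. Y j \<rho> \<theta> \<eta> $ s)"
  shows "laurent b V (e + sum_list (map p js)) (D + sum_list (map q js))
    (\<lambda>\<rho> \<theta> \<eta>. contract (\<lambda>c. G c \<rho> \<theta> \<eta>) (map (\<lambda>j. Y j \<rho> \<theta> \<eta>) js))"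
  using assms
proof (induction js arbitrary: G)
  case (Cons j js)
  have "laurent b V (p j + (e + sum_list (map p js))) (q j + (D + sum_list (map q js)))
      (\<lambda>\<rho> \<theta> \<eta>. \<Sum>s\<in>UNIV. Y j \<rho> \<theta> \<eta> $ s * contract (\<lambda>c. G (s # c) \<rho> \<theta> \<eta>) (map (\<lambda>j. Y j \<rho> \<theta> \<eta>) js))"
    using Cons.prems by (intro laurent_sum laurent_mult Cons.IH) auto
  then show ?case
    by (simp add: add_ac)
qed simp

section \<open>The recursion for the averaged functions\<close>

lemma sum_list_concat_replicate:
  "sum_list (concat (map (\<lambda>j. replicate (a j) j) js)) = (\<Sum>j\<leftarrow>js. a j * j)" for a :: "nat \<Rightarrow> nat"
  by (induction js) (auto simp: sum_list_replicate)

text \<open>In the term for \<open>l\<close> and \<open>\<beta>\<close>, the derivative of order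
  \<open>L\<close> has pole order \<open>i - l - 1 + L\<close>, and its arguments add the sum of the
  \<open>\<beta>\<^sub>j (j - 1)\<close>, which is \<open>l - L\<close>; the total is
  \<open>i - 1\<close>. The degrees \<open>(i - l) m\<close> and \<open>l m\<close> add up to
  \<open>i m\<close>. Integration preserves both.\<close>

lemma avg_y_laurent:
  fixes F :: "('v \<Rightarrow> real) \<Rightarrow> nat \<Rightarrow> real \<Rightarrow> real ^ ('d::finite option) \<Rightarrow> real ^ ('d option)"
  assumes F: "\<And>i j. i \<in> {1..k} \<Longrightarrow> laurent b V (i - 1) (i * m) (\<lambda>\<rho> \<theta> \<eta>. F \<rho> i \<theta> \<eta> $ j)"
    and "i \<in> {1..k}"
  shows "laurent b V (i - 1) (i * m) (\<lambda>\<rho> \<theta> \<eta>. avg_y (F \<rho>) i \<theta> \<eta> $ j)"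
  using assms(2)
proof (induction i arbitrary: j rule: less_induct)
  case (less i)
  \<comment> \<open>Each index \<open>j\<close> occurs \<open>\<beta>\<^sub>j\<close> times, so the
    arguments of the derivative become a \<open>map\<close> over a single list.\<close>
  define js where "js \<beta> l = concat (map (\<lambda>j. replicate (\<beta> ! (j - 1)) j) [1..<Suc l])" for \<beta> :: "nat list" and l
  define r :: "nat list \<Rightarrow> nat \<Rightarrow> real"
    where "r \<beta> l = 1 / (\<Prod>j=1..l. fact (\<beta> ! (j - 1)) * fact j ^ (\<beta> ! (j - 1)))" for \<beta> l
  define T where "T \<beta> l = (\<lambda>\<rho> \<theta> \<eta>. iter_frechet (F \<rho> (i - l) \<theta>) \<eta>
      (map (\<lambda>j. avg_y (F \<rho>) j \<theta> \<eta>) (js \<beta> l)))" for \<beta> l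
  have T: "laurent b V (i - 1) (i * m) (\<lambda>\<rho> \<theta> \<eta>. T \<beta> l \<rho> \<theta> \<eta> $ j)"
    if l: "l \<in> {1..<i}" and \<beta>: "\<beta> \<in> weight_tuples l" for \<beta> l j
  proof -
    have js: "j \<ge> 1 \<and> j < i \<and> j \<in> {1..k}" if "j \<in> set (js \<beta> l)" for j
      using that l less.prems by (auto simp: js_def)
    have "sum_list (js \<beta> l) = (\<Sum>j\<leftarrow>[1..<Suc l]. \<beta> ! (j - 1) * j)"
      unfolding js_def by (rule sum_list_concat_replicate)
    also have "\<dots> = (\<Sum>j=1..l. j * \<beta> ! (j - 1))"
      by (simp add: interv_sum_list_conv_sum_set_nat atLeastLessThanSuc_atLeastAtMost mult.commute del: upt_Suc)
    finally have sum_js: "sum_list (js \<beta> l) = l"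
      using \<beta> by (simp add: weight_tuples_def)
    \<comment> \<open>All entries are at least 1, so no subtraction is truncated.\<close>
    have "(\<Sum>j\<leftarrow>xs. j - 1) + length xs = sum_list xs" if "\<forall>j\<in>set xs. j \<ge> 1" for xs :: "nat list"
      using that by (induction xs) auto
    then have exp: "(\<Sum>j\<leftarrow>js \<beta> l. j - 1) + length (js \<beta> l) = l"
      using js sum_js by simp
    have "i - l \<in> {1..k}"
      using l less.prems by auto
    from iter_frechet_laurent[OF F[OF this], of "length (js \<beta> l)"]
    obtain G where G: "\<And>j c. length c = length (js \<beta> l) \<Longrightarrow>
        laurent b V (i - l - 1 + length (js \<beta> l)) ((i - l) * m) (G j c)"
      and iter: "\<And>\<rho> \<theta> z ws j. \<rho> b \<noteq> 0 \<Longrightarrow> \<theta> \<ge> 0 \<Longrightarrow> z $ None > 0 \<Longrightarrow> length ws = length (js \<beta> l) \<Longrightarrow>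
        iter_frechet (F \<rho> (i - l) \<theta>) z ws $ j = contract (\<lambda>c. G j c \<rho> \<theta> z) ws"
      by blast
    have "laurent b V (i - l - 1 + length (js \<beta> l) + (\<Sum>j\<leftarrow>js \<beta> l. j - 1)) ((i - l) * m + (\<Sum>j\<leftarrow>js \<beta> l. j * m))
        (\<lambda>\<rho> \<theta> \<eta>. contract (\<lambda>c. G j c \<rho> \<theta> \<eta>) (map (\<lambda>j. avg_y (F \<rho>) j \<theta> \<eta>) (js \<beta> l)))"
      using G js less.IH by (intro contract_laurent) auto
    moreover have "i - l - 1 + length (js \<beta> l) + (\<Sum>j\<leftarrow>js \<beta> l. j - 1) = i - 1"
      using exp l by simp
    moreover have "(i - l) * m + (\<Sum>j\<leftarrow>js \<beta> l. j * m) = i * m"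
      using l sum_js by (simp add: sum_list_mult_const flip: distrib_right)
    ultimately have "laurent b V (i - 1) (i * m)
        (\<lambda>\<rho> \<theta> \<eta>. contract (\<lambda>c. G j c \<rho> \<theta> \<eta>) (map (\<lambda>j. avg_y (F \<rho>) j \<theta> \<eta>) (js \<beta> l)))"
      by simp
    then show ?thesis
      by (rule laurent_cong) (simp add: T_def iter)
  qed
  define W where "W = (\<lambda>\<rho> \<theta> \<eta>. F \<rho> i \<theta> \<eta> + (\<Sum>l\<in>{1..<i}. \<Sum>\<beta>\<in>weight_tuples l. r \<beta> l *\<^sub>R T \<beta> l \<rho> \<theta> \<eta>))"
  have W: "laurent b V (i - 1) (i * m) (\<lambda>\<rho> \<theta> \<eta>. W \<rho> \<theta> \<eta> $ j)" for j
    unfolding W_def vector_add_component sum_component vector_scaleR_component real_scaleR_def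
    using F less.prems T by (intro laurent_add laurent_sum laurent_mult_const)
  have avg: "avg_y (F \<rho>) i \<theta> \<eta> = fact i *\<^sub>R integral {0..\<theta>} (\<lambda>\<tau>. W \<rho> \<tau> \<eta>)" for \<rho> \<theta> \<eta>
    unfolding avg_y.simps[of "F \<rho>" i] W_def T_def r_def js_def
    by (simp add: map_concat o_def del: upt_Suc)
  from laurent_mult_const[OF laurent_integral[OF W]]
  have "laurent b V (i - 1) (i * m) (\<lambda>\<rho> \<theta> \<eta>. fact i * integral {0..\<theta>} (\<lambda>\<tau>. W \<rho> \<tau> \<eta> $ j))" .
  then show ?case
  proof (rule laurent_cong)
    fix \<rho> :: "'v \<Rightarrow> real" and \<theta> :: real and \<eta> :: "real ^ 'd option"
    assume "\<rho> b \<noteq> 0" "\<eta> $ None > 0"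
    \<comment> \<open>Integrability of the vector-valued integrand lets components commute with the
      integral.\<close>
    then have "continuous_on {0..\<theta>} (\<lambda>\<tau>. \<chi> j. W \<rho> \<tau> \<eta> $ j)"
      by (intro continuous_on_vec_lambda laurent_continuous[OF W])
    then have "(\<lambda>\<tau>. W \<rho> \<tau> \<eta>) integrable_on {0..\<theta>}"
      by (intro integrable_continuous_real) simp
    then show "avg_y (F \<rho>) i \<theta> \<eta> $ j = fact i * integral {0..\<theta>} (\<lambda>\<tau>. W \<rho> \<tau> \<eta> $ j)"
      by (simp add: avg)
  qed
qed

section \<open>Polynomials with coefficients in the field of rational functions\<close>

definition var_power :: "'v \<Rightarrow> nat \<Rightarrow> ('v, real) mpoly" where
  "var_power v M = Poly_Mapping.single (Poly_Mapping.single v M) 1"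

lemma var_power_eval [simp]: "real_mpoly_eval x (var_power v M) = x v ^ M"
  by (simp add: var_power_def)

lemma var_power_neq_0 [simp]: "var_power v M \<noteq> 0"
proof
  assume "var_power v M = 0"
  then have "real_mpoly_eval (\<lambda>_. 1) (var_power v M) = 0"
    by (simp only: real_mpoly_eval_0)
  then show False
    by simp
qed

lemma var_power_add: "var_power v M * var_power v M' = var_power v (M + M')"
  by (simp add: var_power_def mult_single flip: single_add)

lemma var_power_mpolys: "v \<in> V \<Longrightarrow> var_power v M \<in> mpolys V"
  by (simp add: var_power_def mpolys_def)

text \<open>The counterpart of \<open>pole_coeffs\<close> in the fraction field. With only powers of
  \<open>b\<close> as denominators, evaluation is defined and additive at every
  \<open>\<rho>\<close> with \<open>\<rho> b \<noteq> 0\<close>.\<close>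

definition pole_ratfuns :: "'v::linorder \<Rightarrow> 'v set \<Rightarrow> 'v ratfun set" where
  "pole_ratfuns b V = {Fract N (var_power b M) |N M. N \<in> mpolys V}"

lemma pole_ratfunsI: "N \<in> mpolys V \<Longrightarrow> Fract N (var_power b M) \<in> pole_ratfuns b V"
  by (auto simp: pole_ratfuns_def)

lemma pole_ratfuns_subset: "b \<in> V \<Longrightarrow> pole_ratfuns b V \<subseteq> ratfuns V"
proof
  fix q assume "b \<in> V" "q \<in> pole_ratfuns b V"
  then obtain N M where "q = Fract N (var_power b M)" "N \<in> mpolys V"
    by (auto simp: pole_ratfuns_def)
  moreover have "var_power b M \<in> mpolys V"
    using \<open>b \<in> V\<close> by (rule var_power_mpolys)
  ultimately show "q \<in> ratfuns V"
    unfolding ratfuns_def using var_power_neq_0[of b M] by blast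
qed

lemma pole_ratfuns_0 [simp]: "0 \<in> pole_ratfuns b V"
proof -
  have "0 = Fract 0 (var_power b 0)"
    by (simp add: fract_collapse)
  then show ?thesis
    by (metis pole_ratfunsI mpolys_0)
qed

lemma pole_ratfuns_add:
  assumes "p \<in> pole_ratfuns b V" "q \<in> pole_ratfuns b V" "b \<in> V"
  shows "p + q \<in> pole_ratfuns b V"
    and "\<rho> b \<noteq> 0 \<Longrightarrow> ratfun_eval \<rho> (p + q) = ratfun_eval \<rho> p + ratfun_eval \<rho> q"
proof -
  obtain N M N' M' where N: "N \<in> mpolys V" "N' \<in> mpolys V"
    and p: "p = Fract N (var_power b M)" and q: "q = Fract N' (var_power b M')"
    using assms unfolding pole_ratfuns_def by blast
  have sum: "p + q = Fract (N * var_power b M' + N' * var_power b M) (var_power b (M + M'))"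
    by (simp add: p q flip: var_power_add)
  show "p + q \<in> pole_ratfuns b V"
    unfolding sum by (intro pole_ratfunsI mpolys_add mpolys_mult var_power_mpolys N assms(3))
  show "ratfun_eval \<rho> (p + q) = ratfun_eval \<rho> p + ratfun_eval \<rho> q" if "\<rho> b \<noteq> 0"
    unfolding sum unfolding p q using that
    by (simp add: ratfun_eval_Fract real_mpoly_eval_add real_mpoly_eval_mult power_add field_simps)
qed

text \<open>At a fixed angle \<open>\<phi> \<theta>\<close> is a real number, absorbed into the
  coefficient, and the factor \<open>R\<^sup>e\<close> clears the denominator. One polynomial serves
  all \<open>\<rho>\<close> and \<open>\<eta>\<close>.\<close>

lemma laurent_imp_mpoly:
  fixes g :: "('v::linorder \<Rightarrow> real) \<Rightarrow> real \<Rightarrow> real ^ ('d::finite option) \<Rightarrow> real"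
  assumes "laurent b V e D g" "b \<in> V" "\<theta> \<ge> 0"
  shows "\<exists>P :: ('d option, 'v ratfun) mpoly. (\<forall>u. Poly_Mapping.lookup P u \<in> pole_ratfuns b V) \<and>
    (\<forall>u\<in>Poly_Mapping.keys P. monomial_degree u \<le> D) \<and>
    (\<forall>\<rho> \<eta>. \<rho> b \<noteq> 0 \<longrightarrow> \<eta> $ None > 0 \<longrightarrow>
      \<eta> $ None ^ e * g \<rho> \<theta> \<eta> = mpoly_eval (ratfun_eval \<rho>) (($) \<eta>) P)"
  using assms(1)
proof induction
  case (laurent_term c \<phi> u)
  then obtain N M where N: "N \<in> mpolys V" and c: "\<And>\<rho>. \<rho> b \<noteq> 0 \<Longrightarrow> c \<rho> = real_mpoly_eval \<rho> N / \<rho> b ^ M"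
    unfolding pole_coeffs_def by blast
  define q where "q = Fract (Poly_Mapping.single 0 (\<phi> \<theta>) * N) (var_power b M)"
  have "q \<in> pole_ratfuns b V"
    unfolding q_def by (intro pole_ratfunsI mpolys_mult mpolys_const N)
  moreover have "ratfun_eval \<rho> q = c \<rho> * \<phi> \<theta>" if "\<rho> b \<noteq> 0" for \<rho>
    using that by (simp add: q_def ratfun_eval_Fract real_mpoly_eval_mult c)
  ultimately show ?case
    using laurent_term(3)
    by (intro exI[of _ "Poly_Mapping.single u q"])
      (auto simp: lookup_single when_def mpoly_eval_single split: if_splits)
next
  case (laurent_add g h)
  obtain P where P: "\<forall>u. Poly_Mapping.lookup P u \<in> pole_ratfuns b V"
    "\<forall>u\<in>Poly_Mapping.keys P. monomial_degree u \<le> D"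
    "\<forall>\<rho> \<eta>. \<rho> b \<noteq> 0 \<longrightarrow> \<eta> $ None > 0 \<longrightarrow>
      \<eta> $ None ^ e * g \<rho> \<theta> \<eta> = mpoly_eval (ratfun_eval \<rho>) (($) \<eta>) P"
    using laurent_add.IH(1) by (elim exE conjE)
  obtain Q where Q: "\<forall>u. Poly_Mapping.lookup Q u \<in> pole_ratfuns b V"
    "\<forall>u\<in>Poly_Mapping.keys Q. monomial_degree u \<le> D"
    "\<forall>\<rho> \<eta>. \<rho> b \<noteq> 0 \<longrightarrow> \<eta> $ None > 0 \<longrightarrow>
      \<eta> $ None ^ e * h \<rho> \<theta> \<eta> = mpoly_eval (ratfun_eval \<rho>) (($) \<eta>) Q"
    using laurent_add.IH(2) by (elim exE conjE)
  show ?case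
  proof (intro exI[of _ "P + Q"] conjI allI ballI impI)
    show "Poly_Mapping.lookup (P + Q) u \<in> pole_ratfuns b V" for u
      unfolding lookup_add using P(1) Q(1) assms(2) by (intro pole_ratfuns_add(1)) auto
    show "monomial_degree u \<le> D" if "u \<in> Poly_Mapping.keys (P + Q)" for u
      using that keys_add[of P Q] P(2) Q(2) by blast
    show "\<eta> $ None ^ e * (g \<rho> \<theta> \<eta> + h \<rho> \<theta> \<eta>) = mpoly_eval (ratfun_eval \<rho>) (($) \<eta>) (P + Q)"
      if "\<rho> b \<noteq> 0" "\<eta> $ None > 0" for \<rho> \<eta>
    proof -
      have "mpoly_eval (ratfun_eval \<rho>) (($) \<eta>) (P + Q) =
          mpoly_eval (ratfun_eval \<rho>) (($) \<eta>) P + mpoly_eval (ratfun_eval \<rho>) (($) \<eta>) Q"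
        using P(1) Q(1) assms(2) that(1) by (intro mpoly_eval_add pole_ratfuns_add(2)) auto
      then show ?thesis
        using P(3) Q(3) that by (simp add: distrib_left)
    qed
  qed
next
  case (laurent_cong g h)
  from laurent_cong.IH show ?case
    by (rule ex_forward) (use laurent_cong.hyps assms(3) in simp)
qed

section \<open>Divisibility by powers of a variable\<close>

lemma mpoly_eval_map:
  assumes "h 0 = 0"
  shows "real_mpoly_eval x (Poly_Mapping.map h P) = mpoly_eval h x P"
proof -
  have lookup: "Poly_Mapping.lookup (Poly_Mapping.map h P) u = h (Poly_Mapping.lookup P u)" for u
    using assms by (simp add: Poly_Mapping.map.rep_eq when_def)
  have "Poly_Mapping.keys (Poly_Mapping.map h P) \<subseteq> Poly_Mapping.keys P"
    using assms by (auto simp: in_keys_iff lookup)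
  then show ?thesis
    using assms by (simp add: real_mpoly_eval_superset[of "Poly_Mapping.keys P"]
        mpoly_eval_superset[of "Poly_Mapping.keys P"] lookup)
qed

lemma real_mpoly_eqI:
  assumes "\<And>x. (\<And>v. x v > 0) \<Longrightarrow> real_mpoly_eval x P = real_mpoly_eval x Q"
  shows "P = Q"
proof -
  have "real_mpoly_eval x (P - Q) = 0" if "\<And>v. x v > 0" for x
    using assms[of x] that real_mpoly_eval_add[of x "P - Q" Q] by simp
  then have "P - Q = 0"
    by (rule mpoly_eq_0_if_eval_eq_0)
  then show ?thesis
    by simp
qed

text \<open>
  A common denominator of the coefficients of \<open>Q\<close> and the numerator of a coefficient of \<open>P\<close> do not
  vanish at some point \<open>\<rho>\<close>. There the identity \<open>P = R\<^sup>d Q\<close> of functions is one of real polynomials.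
\<close>

lemma pole_poly_divisible:
  fixes P Q :: "('i, 'v::linorder ratfun) mpoly"
  assumes P: "\<And>u. Poly_Mapping.lookup P u \<in> pole_ratfuns b V"
    and Q: "\<And>u. Poly_Mapping.lookup Q u \<in> ratfuns V"
    and eq: "\<And>\<rho> x. \<rho> b \<noteq> 0 \<Longrightarrow> (\<And>v. x v > 0) \<Longrightarrow>
      (\<And>u. ratfun_defined_at (Poly_Mapping.lookup Q u) \<rho>) \<Longrightarrow>
      mpoly_eval (ratfun_eval \<rho>) x P = x r ^ d * mpoly_eval (ratfun_eval \<rho>) x Q"
    and u: "u \<in> Poly_Mapping.keys P"
  shows "d \<le> Poly_Mapping.lookup u r"
proof -
  obtain N M where NM: "Poly_Mapping.lookup P u = Fract N (var_power b M)"
    using P[of u] by (auto simp: pole_ratfuns_def)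
  then have "N \<noteq> 0"
    using u by (auto simp: in_keys_iff fract_collapse)
  have "\<forall>w. \<exists>D. D \<noteq> 0 \<and> (\<exists>N. Poly_Mapping.lookup Q w = Fract N D)"
    using Q by (fastforce simp: ratfuns_def)
  then obtain D where D: "\<And>w. D w \<noteq> 0" "\<And>w. \<exists>N. Poly_Mapping.lookup Q w = Fract N (D w)"
    by metis
  have "N * (\<Prod>w\<in>Poly_Mapping.keys Q. D w) \<noteq> 0"
    using \<open>N \<noteq> 0\<close> D(1) by simp
  then obtain \<rho> where pos: "\<And>v. \<rho> v > 0"
    and nz: "real_mpoly_eval \<rho> (N * (\<Prod>w\<in>Poly_Mapping.keys Q. D w)) \<noteq> 0"
    using mpoly_eq_0_if_eval_eq_0 by metis
  have "real_mpoly_eval \<rho> N \<noteq> 0" and D_nz: "\<And>w. w \<in> Poly_Mapping.keys Q \<Longrightarrow> real_mpoly_eval \<rho> (D w) \<noteq> 0"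
    using nz by (auto simp: real_mpoly_eval_mult real_mpoly_eval_prod)
  have b: "\<rho> b \<noteq> 0"
    using pos[of b] by simp
  have defined: "ratfun_defined_at (Poly_Mapping.lookup Q w) \<rho>" for w
  proof (cases "w \<in> Poly_Mapping.keys Q")
    case True
    then show ?thesis
      using D(2)[of w] D_nz[of w] unfolding ratfun_defined_at_def real_mpoly_eval_def[symmetric] by blast
  next
    \<comment> \<open>A coefficient outside the support is the fraction 0 / 1, defined
      everywhere.\<close>
    case False
    then show ?thesis
      unfolding ratfun_defined_at_def real_mpoly_eval_def[symmetric]
      by (intro exI[of _ 0] exI[of _ 1]) (simp add: in_keys_iff fract_collapse)
  qed
  let ?h = "ratfun_eval \<rho>"
  let ?R = "Poly_Mapping.single (Poly_Mapping.single r d) (1 :: real)"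
  have "Poly_Mapping.map ?h P = ?R * Poly_Mapping.map ?h Q"
    by (rule real_mpoly_eqI) (simp add: real_mpoly_eval_mult mpoly_eval_map eq[OF b _ defined])
  \<comment> \<open>The numerator \<open>N\<close> does not vanish at \<open>\<rho>\<close>, so
    \<open>u\<close> survives the specialization and must be a multiple of the \<open>d\<close>-th
    power of \<open>r\<close>.\<close>
  moreover have "u \<in> Poly_Mapping.keys (Poly_Mapping.map ?h P)"
    using u b \<open>real_mpoly_eval \<rho> N \<noteq> 0\<close>
    by (simp add: in_keys_iff Poly_Mapping.map.rep_eq NM ratfun_eval_Fract)
  ultimately obtain w where "u = Poly_Mapping.single r d + w"
    using keys_mult[of ?R "Poly_Mapping.map ?h Q"] by auto
  then show ?thesis
    by (simp add: lookup_add)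
qed

section \<open>The least power of R and the degree bound\<close>

theorem theorem5:
  fixes n m k i :: nat and j :: "'d::finite option"
  assumes "n \<ge> 3" and "CARD('d) = n - 2" and "m \<ge> 2" and "k \<ge> 1" and "i \<in> {1..k}"
  shows "\<exists>\<mu>\<le>i - 1.
           (\<exists>Q\<in>eta_polys m k. represents Q (scaled_averaged_fun m k i j \<mu>) \<and>
              mpoly_total_degree Q \<le> i * m) \<and>
           (\<forall>\<nu><\<mu>. \<not> (\<exists>Q\<in>eta_polys m k. represents Q (scaled_averaged_fun m k i j \<nu>)))"
proof -
  let ?V = "params m k :: 'd param set"
  have b: "PB \<in> ?V"
    by (simp add: params_def)
  have "laurent PB ?V (i - 1) (i * m) (\<lambda>\<rho> \<theta> \<eta>. avg_y (sf_coeff \<rho> m k) i \<theta> \<eta> $ j)"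
    using assms by (intro avg_y_laurent laurent_sf_coeff) auto
  note avg = laurent_mult_const[OF this, of "1 / fact i"]
  have averaged: "averaged_fun \<rho> m k i \<eta> $ j = 1 / fact i * avg_y (sf_coeff \<rho> m k) i (2 * pi) \<eta> $ j" for \<rho> \<eta>
    by (simp add: averaged_fun_def divide_inverse)
  have "2 * pi \<ge> 0"
    by simp
  from laurent_imp_mpoly[OF avg b this] obtain P :: "('d option, 'd param ratfun) mpoly"
    where P: "\<And>u. Poly_Mapping.lookup P u \<in> pole_ratfuns PB ?V"
      and deg: "\<And>u. u \<in> Poly_Mapping.keys P \<Longrightarrow> monomial_degree u \<le> i * m"
      and P_eval: "\<And>\<rho> \<eta>. \<rho> PB \<noteq> 0 \<Longrightarrow> \<eta> $ None > 0 \<Longrightarrow>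
        \<eta> $ None ^ (i - 1) * averaged_fun \<rho> m k i \<eta> $ j = mpoly_eval (ratfun_eval \<rho>) (($) \<eta>) P"
    unfolding averaged by blast
  \<comment> \<open>Minimality refers to representing polynomials of any degree. A polynomial for
    the least exponent thus carries no degree bound; it only serves to show that \<open>P\<close> is
    divisible by a power of R.\<close>
  define admissible where
    "admissible \<mu> \<longleftrightarrow> (\<exists>Q\<in>eta_polys m k. represents Q (scaled_averaged_fun m k i j \<mu>))" for \<mu>
  define \<mu> where "\<mu> = (LEAST \<mu>. admissible \<mu>)"
  have "P \<in> eta_polys m k"
    using P pole_ratfuns_subset[OF b] by (auto simp: eta_polys_def)
  moreover have "represents P (scaled_averaged_fun m k i j (i - 1))"
    using P_eval by (auto simp: represents_def scaled_averaged_fun_def)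
  ultimately have "admissible (i - 1)"
    by (auto simp: admissible_def)
  then have "admissible \<mu>" "\<mu> \<le> i - 1"
    unfolding \<mu>_def by (rule LeastI, rule Least_le)
  then obtain Q0 where Q0: "\<And>u. Poly_Mapping.lookup Q0 u \<in> ratfuns ?V"
    "represents Q0 (scaled_averaged_fun m k i j \<mu>)"
    by (auto simp: admissible_def eta_polys_def)
  define d where "d = i - 1 - \<mu>"
  have "i - 1 = d + \<mu>"
    using \<open>\<mu> \<le> i - 1\<close> by (simp add: d_def)
  then have P_eval': "\<eta> $ None ^ d * (\<eta> $ None ^ \<mu> * averaged_fun \<rho> m k i \<eta> $ j) =
      mpoly_eval (ratfun_eval \<rho>) (($) \<eta>) P"
    if "\<rho> PB \<noteq> 0" "\<eta> $ None > 0" for \<rho> \<eta>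
    using P_eval[of \<rho>, OF that] by (simp only: power_add mult.assoc)
  have divisible: "d \<le> Poly_Mapping.lookup u None" if "u \<in> Poly_Mapping.keys P" for u
  proof (rule pole_poly_divisible[OF P Q0(1) _ that])
    fix \<rho> :: "'d param \<Rightarrow> real" and x :: "'d option \<Rightarrow> real"
    assume "\<rho> PB \<noteq> 0" and pos: "\<And>v. x v > 0"
      and defined: "\<And>u. ratfun_defined_at (Poly_Mapping.lookup Q0 u) \<rho>"
    define \<eta> where "\<eta> = (\<chi> v. x v)"
    have \<eta>: "($) \<eta> = x" "\<eta> $ None > 0"
      using pos by (auto simp: \<eta>_def)
    have "\<eta> $ None ^ \<mu> * averaged_fun \<rho> m k i \<eta> $ j = mpoly_eval (ratfun_eval \<rho>) (($) \<eta>) Q0"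
      using Q0(2) \<open>\<rho> PB \<noteq> 0\<close> \<eta>(2) defined unfolding represents_def scaled_averaged_fun_def by blast
    then show "mpoly_eval (ratfun_eval \<rho>) x P = x None ^ d * mpoly_eval (ratfun_eval \<rho>) x Q0"
      using P_eval'[of \<rho>, OF \<open>\<rho> PB \<noteq> 0\<close> \<eta>(2)] by (simp add: \<eta>(1))
  qed
  \<comment> \<open>The quotient of \<open>P\<close> by \<open>R\<^sup>d\<close> arises by
    reindexing: by \<open>divisible\<close>, every monomial of \<open>P\<close> is the
    \<open>shift\<close> of exactly one monomial of \<open>Q\<close>.\<close>
  define shift where "shift u = u + Poly_Mapping.single None d" for u :: "'d option \<Rightarrow>\<^sub>0 nat"
  have "inj shift"
    by (auto simp: inj_def shift_def)
  define Q where "Q = Poly_Mapping.map_key shift P"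
  have lookup_Q: "Poly_Mapping.lookup Q u = Poly_Mapping.lookup P (shift u)" for u
    by (simp add: Q_def map_key.rep_eq[OF \<open>inj shift\<close>])
  have "u \<in> shift ` Poly_Mapping.keys Q" if "u \<in> Poly_Mapping.keys P" for u
  proof (rule image_eqI)
    show *: "u = shift (u - Poly_Mapping.single None d)"
      using divisible[OF that]
      by (auto intro!: poly_mapping_eqI simp: shift_def lookup_add lookup_minus lookup_single when_def)
    show "u - Poly_Mapping.single None d \<in> Poly_Mapping.keys Q"
      using that * by (simp add: in_keys_iff lookup_Q)
  qed
  then have keys: "Poly_Mapping.keys P = shift ` Poly_Mapping.keys Q"
    by (auto simp: in_keys_iff lookup_Q)
  have Q_eval: "mpoly_eval (ratfun_eval \<rho>) (($) \<eta>) P =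
      \<eta> $ None ^ d * mpoly_eval (ratfun_eval \<rho>) (($) \<eta>) Q" for \<rho> and \<eta> :: "real ^ 'd option"
  proof -
    have "mpoly_eval (ratfun_eval \<rho>) (($) \<eta>) P = (\<Sum>u\<in>Poly_Mapping.keys Q.
        ratfun_eval \<rho> (Poly_Mapping.lookup Q u) * monomial_eval (($) \<eta>) (shift u))"
      using \<open>inj shift\<close> by
        (simp add: mpoly_eval_superset[OF _ order_refl] keys sum.reindex inj_on_def inj_def lookup_Q)
    then show ?thesis
      by (simp add: mpoly_eval_superset[OF _ order_refl] shift_def monomial_eval_add sum_distrib_left mult_ac)
  qed
  have "Q \<in> eta_polys m k"
    using P pole_ratfuns_subset[OF b] by (auto simp: eta_polys_def lookup_Q)
  moreover have "represents Q (scaled_averaged_fun m k i j \<mu>)"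
    unfolding represents_def scaled_averaged_fun_def
  proof (intro allI impI)
    fix \<rho> :: "'d param \<Rightarrow> real" and \<eta> :: "real ^ 'd option"
    assume "\<rho> PB \<noteq> 0" and R: "\<eta> $ None > 0"
    from P_eval'[of \<rho>, OF this] have "\<eta> $ None ^ d * (\<eta> $ None ^ \<mu> * averaged_fun \<rho> m k i \<eta> $ j) =
        \<eta> $ None ^ d * mpoly_eval (ratfun_eval \<rho>) (($) \<eta>) Q"
      by (simp only: Q_eval)
    then show "\<eta> $ None ^ \<mu> * averaged_fun \<rho> m k i \<eta> $ j = mpoly_eval (ratfun_eval \<rho>) (($) \<eta>) Q"
      using R by simp
  qed
  \<comment> \<open>\<open>shift\<close> never lowers a degree, so the bound for \<open>P\<close>
    passes to \<open>Q\<close>.\<close>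
  moreover have "monomial_degree u \<le> i * m" if "u \<in> Poly_Mapping.keys Q" for u
    using deg[of "shift u"] that by (simp add: keys shift_def monomial_degree_add)
  then have "mpoly_total_degree Q \<le> i * m"
    by (auto simp: mpoly_total_degree_def monomial_degree_def)
  moreover have "\<not> admissible \<nu>" if "\<nu> < \<mu>" for \<nu>
    using that unfolding \<mu>_def by (rule not_less_Least)
  ultimately show ?thesis
    using \<open>\<mu> \<le> i - 1\<close> unfolding admissible_def by blast
qed

end
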